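(* In the setting of the context, let $1\le p\le\infty$, $\frac1p+\frac1q=1$, let $F\in H_{\boldsymbol\gamma,p}$ and let $\{\gamma_j\}_{j\ge1}\in\ell^{p^*}(\mathbb N)$ for some $p^*\in(0,q)$. For a requested error tolerance $\epsilon>0$ let the active set be, for any $\rho\in(1,q/p^*]$, $$\mathfrak U(\epsilon,q,\rho)=\left\{\mathfrak u\subset\mathbb N,\ |\mathfrak u|<\infty:\ (\gamma_{\mathfrak u}M_{\mathfrak u})^{1-1/\rho}>\frac{\epsilon/2}{\left(\sum_{|\mathfrak v|<\infty}(\gamma_{\mathfrak v}M_{\mathfrak v})^{q/\rho}\right)^{1/q}}\right\},$$ and for all $\mathfrak u\in\mathfrak U(\epsilon,q,\rho)$ let $n_{\mathfrak u}=2^{\lfloor\log_2k_{\mathfrak u}\rfloor}$ if $k_{\mathfrak u}\ge1$ and $n_{\mathfrak u}=0$ otherwise, with $k_{\mathfrak u}$ as in the context. Let the MDM algorithm $$Q_\epsilon(F)=\sum_{\mathfrak u\in\mathfrak U(\epsilon,q,\rho)}Q_{\mathfrak u,n_{\mathfrak u}}(F_{\mathfrak u})=\sum_{\mathfrak u\in\mathfrak U(\epsilon,q,\rho)}\sum_{k=0}^{n_{\mathfrak u}-1}w^{(k)}_{\mathfrak u}F_{\mathfrak u}(\boldsymbol y^{(k)}_{\mathfrak u})$$ be based on cubature rules satisfying $$|I_{\mathfrak u}(F_{\mathfrak u})-Q_{\mathfrak u,n}(F_{\mathfrak u})|\le\|F_{\mathfrak u}\|_{H(K_{\mathfrak u})}\,C_{\mathfrak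 u,\lambda}\,\frac{\max\{1,(\ln n)^{\lambda_1|\mathfrak u|}\}}{\max\{1,n^\lambda\}}$$ with $0<\lambda\le\frac1{p^*}-\frac1q$ and $0\le\lambda_1<\lambda+\frac1q$, and where $C_{\mathfrak u,\lambda}$ and $\pounds_{\mathfrak u}$ are at most exponential in $|\mathfrak u|$. Then $$|I(F)-Q_\epsilon(F)|\le\epsilon\,\|F\|_{H_{\boldsymbol\gamma,p}}\max\left\{1,\max_{\mathfrak u\in\mathfrak U(\epsilon,q,\rho)}\left(\frac{\ln(n_{\mathfrak u})}{|\mathfrak u|}\right)^{\lambda_1|\mathfrak u|}\right\}=\|F\|_{H_{\boldsymbol\gamma,p}}\,\epsilon^{1-\delta(\epsilon)},$$ where $\delta(\epsilon)=O\!\left(\ln(\ln(\ln(\epsilon^{-1})))/\ln(\ln(\epsilon^{-1}))\right)=o(1)$ as $\epsilon\to0$. Furthermore the computational cost is bounded by $\mathrm{cost}(Q_\epsilon)\lesssim\epsilon^{-1/\lambda}$, with implied constant independent of $\epsilon$.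
   Context: **Integration problem.** $\Omega\subseteq\mathbb R$ carries a probability measure $\mu$ (the same symbol denotes the countable product measure on $\Omega^{\mathbb N}$), and $I(F)=\int_{\Omega^{\mathbb N}}F\,d\mu$. For finite $\mathfrak u\subset\mathbb N$, $\boldsymbol y_{\mathfrak u}$ collects the variables $y_j$, $j\in\mathfrak u$, $\mu_{\mathfrak u}$ is the product measure on $\Omega_{\mathfrak u}=\Omega^{|\mathfrak u|}$ and $I_{\mathfrak u}(F_{\mathfrak u})=\int_{\Omega_{\mathfrak u}}F_{\mathfrak u}\,d\mu_{\mathfrak u}$. **Spaces.** $K$ is a reproducing kernel on $\Omega$ with $M=\int_\Omega K(y,y)^{1/2}d\mu(y)<\infty$; $K_{\mathfrak u}(\boldsymbol x_{\mathfrak u},\boldsymbol y_{\mathfrak u})=\prod_{j\in\mathfrak u}K(x_j,y_j)$, $H(K_{\mathfrak u})$ is its reproducing kernel Hilbert space, and $M_{\mathfrak u}=M^{|\mathfrak u|}$. $\{\gamma_j\}$ is a positive sequence and $\gamma_{\mathfrak u}=\prod_{j\in\mathfrak u}\gamma_j$ (empty product $1$). $F\in H_{\boldsymbol\gamma,p}$ means that $F(\boldsymbol y)=\sum_{|\mathfrak u|<\infty}F_{\mathfrak u}(\boldsymbol y_{\mathfrak u})$ (sum over all finite subsets of $\mathbb N$) with given $F_{\mathfrak u}\in H(K_{\mathfrak u})$ and finite norm $$\|F\|_{H_{\boldsymbol\gamma,p}}=\Big(\sum_{|\mathfrak u|<\infty}(\gamma_{\mathfrak u}^{-1}\|F_{\mathfrak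 u}\|_{H(K_{\mathfrak u})})^p\Big)^{1/p}$$ (supremum if $p=\infty$). **Cubature rules.** $Q_{\mathfrak u,n}(F_{\mathfrak u})=\sum_{k=0}^{n-1}w_{\mathfrak u}^{(k)}F_{\mathfrak u}(\boldsymbol y_{\mathfrak u}^{(k)})$ is a rule with $n$ nodes and weights (with $Q_{\mathfrak u,0}=0$), available for $n=0$ and $n$ a power of $2$; the error bound in the claim is required for all $F_{\mathfrak u}\in H(K_{\mathfrak u})$, with $C_{\mathfrak u,\lambda}>0$; for $n=0$ its fraction is read as $1$. **Cost.** $\mathrm{cost}(Q_\epsilon)=\sum_{\mathfrak u\in\mathfrak U(\epsilon,q,\rho)}n_{\mathfrak u}\pounds_{\mathfrak u}$, where $\pounds_{\mathfrak u}\ge1$ is the cost of one evaluation of $F_{\mathfrak u}$ and depends only on $|\mathfrak u|$. "At most exponential in $|\mathfrak u|$" means bounded by $c\,T^{|\mathfrak u|}$ for constants $c,T>0$ independent of $\mathfrak u$. **Choice of $k_{\mathfrak u}$.** For $1\le q<\infty$, $$k_{\mathfrak u}=\Big(\frac\epsilon2\Big)^{-1/\lambda}\left(\frac{\gamma_{\mathfrak u}2^\lambda C_{\mathfrak u,\lambda}|\mathfrak u|^{\lambda_1|\mathfrak u|}}{\pounds_{\mathfrak u}^{1/q}}\right)^{q/(q\lambda+1)}L_\epsilon^{1/(q\lambda)},$$ $$L_\epsilon=\sum_{\mathfrak u\in\mathfrak U(\epsilon,q,\rho)}\pounds_{\mathfrak u}^{q\lambda/(q\lambda+1)}\big(\gamma_{\mathfrak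 u}2^\lambda C_{\mathfrak u,\lambda}|\mathfrak u|^{\lambda_1|\mathfrak u|}\big)^{q/(q\lambda+1)};$$ for $q=\infty$, $k_{\mathfrak u}=(\epsilon/2)^{-1/\lambda}\big(\gamma_{\mathfrak u}2^\lambda C_{\mathfrak u,\lambda}|\mathfrak u|^{\lambda_1|\mathfrak u|}\big)^{1/\lambda}$. **Conventions.** $0^0=1$. For $q=\infty$, the denominator in the active set is $\sup_{|\mathfrak v|<\infty}(\gamma_{\mathfrak v}M_{\mathfrak v})^{1/\rho}$ and $\rho=\infty$ is allowed (with $1/\rho=0$). In the inner maximum only nonempty $\mathfrak u$ with $n_{\mathfrak u}\ge1$ are taken into account. *)

theory Defs
  imports "HOL-Probability.Probability" "HOL-Library.Landau_Symbols"
begin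

text \<open>
  Powers of nonnegative reals with the convention \<open>0\<^sup>0 = 1\<close> (whereas \<open>0 powr 0 = 0\<close>).
\<close>
definition rpow :: "real \<Rightarrow> real \<Rightarrow> real" where
  "rpow x a = (if a = 0 then 1 else x powr a)"

definition reproducing_kernel_on :: "'a set \<Rightarrow> ('a \<Rightarrow> 'a \<Rightarrow> real) \<Rightarrow> bool" where
  "reproducing_kernel_on X K \<longleftrightarrow>
     (\<forall>x\<in>X. \<forall>y\<in>X. K x y = K y x) \<and>
     (\<forall>S c. finite S \<and> S \<subseteq> X \<longrightarrow> 0 \<le> (\<Sum>x\<in>S. \<Sum>y\<in>S. c x * c y * K x y))"

definition kernel_section :: "'a set \<Rightarrow> ('a \<Rightarrow> 'a \<Rightarrow> real) \<Rightarrow> 'a \<Rightarrow> 'a \<Rightarrow> real" where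
  "kernel_section X K y = (\<lambda>x. if x \<in> X then K x y else 0)"

definition ip_norm :: "('f \<Rightarrow> 'f \<Rightarrow> real) \<Rightarrow> 'f \<Rightarrow> real" where
  "ip_norm ip f = sqrt (ip f f)"

text \<open>
  \<open>rkhs X K H ip\<close>: the set of functions \<open>H\<close> with the inner product \<open>ip\<close> is the reproducing
  kernel Hilbert space on \<open>X\<close> with kernel \<open>K\<close>. A function on \<open>X\<close> is represented by
  its extension by zero to the whole type, so that \<open>H\<close>, and \<open>ip\<close> on \<open>H\<close>, are
  uniquely determined by \<open>X\<close> and \<open>K\<close>.
\<close>
locale rkhs =
  fixes X :: "'a set"
    and K :: "'a \<Rightarrow> 'a \<Rightarrow> real"
    and H :: "('a \<Rightarrow> real) set"
    and ip :: "('a \<Rightarrow> real) \<Rightarrow> ('a \<Rightarrow> real) \<Rightarrow> real"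
  assumes zero_outside: "f \<in> H \<Longrightarrow> x \<notin> X \<Longrightarrow> f x = 0"
    and zero_mem: "(\<lambda>x. 0) \<in> H"
    and add_mem: "f \<in> H \<Longrightarrow> g \<in> H \<Longrightarrow> (\<lambda>x. f x + g x) \<in> H"
    and scale_mem: "f \<in> H \<Longrightarrow> (\<lambda>x. c * f x) \<in> H"
    and ip_commute: "f \<in> H \<Longrightarrow> g \<in> H \<Longrightarrow> ip f g = ip g f"
    and ip_add: "f \<in> H \<Longrightarrow> g \<in> H \<Longrightarrow> h \<in> H \<Longrightarrow> ip (\<lambda>x. f x + g x) h = ip f h + ip g h"
    and ip_scale: "f \<in> H \<Longrightarrow> g \<in> H \<Longrightarrow> ip (\<lambda>x. c * f x) g = c * ip f g"
    and ip_nonneg: "f \<in> H \<Longrightarrow> 0 \<le> ip f f"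
    and ip_definite: "f \<in> H \<Longrightarrow> ip f f = 0 \<Longrightarrow> f = (\<lambda>x. 0)"
    and complete: "(\<And>i::nat. s i \<in> H) \<Longrightarrow>
      (\<And>e. e > 0 \<Longrightarrow> \<exists>N. \<forall>i\<ge>N. \<forall>j\<ge>N. ip_norm ip (\<lambda>x. s i x - s j x) < e) \<Longrightarrow>
      \<exists>f\<in>H. (\<lambda>i. ip_norm ip (\<lambda>x. s i x - f x)) \<longlonglongrightarrow> 0"
    and section_mem: "y \<in> X \<Longrightarrow> kernel_section X K y \<in> H"
    and reproducing: "f \<in> H \<Longrightarrow> y \<in> X \<Longrightarrow> ip f (kernel_section X K y) = f y"

text \<open>
  The coordinates are indexed by all of \<open>nat\<close>. A point of the domain of a function of
  the variables in \<open>u\<close> is an element of \<open>u \<rightarrow>\<^sub>E \<Omega>\<close>; for \<open>u = {}\<close> this is a one-point set.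
\<close>
definition product_kernel ::
    "(real \<Rightarrow> real \<Rightarrow> real) \<Rightarrow> nat set \<Rightarrow> (nat \<Rightarrow> real) \<Rightarrow> (nat \<Rightarrow> real) \<Rightarrow> real" where
  "product_kernel K u x y = (\<Prod>j\<in>u. K (x j) (y j))"

definition weight :: "(nat \<Rightarrow> real) \<Rightarrow> nat set \<Rightarrow> real" where
  "weight \<gamma> u = (\<Prod>j\<in>u. \<gamma> j)"

definition scaled_norm ::
    "(nat \<Rightarrow> real) \<Rightarrow> (nat set \<Rightarrow> ('f \<Rightarrow> 'f \<Rightarrow> real)) \<Rightarrow> (nat set \<Rightarrow> 'f) \<Rightarrow> nat set \<Rightarrow> real" where
  "scaled_norm \<gamma> ip Fu u = inverse (weight \<gamma> u) * ip_norm (ip u) (Fu u)"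

definition H_norm ::
    "(nat \<Rightarrow> real) \<Rightarrow> ereal \<Rightarrow> (nat set \<Rightarrow> ('f \<Rightarrow> 'f \<Rightarrow> real)) \<Rightarrow> (nat set \<Rightarrow> 'f) \<Rightarrow> real" where
  "H_norm \<gamma> p ip Fu =
     (if p = \<infinity> then (SUP u\<in>{u. finite u}. scaled_norm \<gamma> ip Fu u)
      else (\<Sum>\<^sub>\<infinity>u\<in>{u. finite u}. scaled_norm \<gamma> ip Fu u powr real_of_ereal p)
             powr (1 / real_of_ereal p))"

definition H_norm_finite ::
    "(nat \<Rightarrow> real) \<Rightarrow> ereal \<Rightarrow> (nat set \<Rightarrow> ('f \<Rightarrow> 'f \<Rightarrow> real)) \<Rightarrow> (nat set \<Rightarrow> 'f) \<Rightarrow> bool" where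
  "H_norm_finite \<gamma> p ip Fu \<longleftrightarrow>
     (if p = \<infinity> then bdd_above (scaled_norm \<gamma> ip Fu ` {u. finite u})
      else (\<lambda>u. scaled_norm \<gamma> ip Fu u powr real_of_ereal p) summable_on {u. finite u})"

text \<open>
  The norm is finite, but when the kernel is unbounded on the diagonal the series
  \<open>\<Sum>\<^sub>u F\<^sub>u(y\<^sub>u)\<close> need only converge outside a null set, so it is required to represent
  \<open>F\<close> almost everywhere. Measurability has to be demanded because the product measure is
  not complete; it is automatic when the series converges to \<open>F\<close> everywhere.
\<close>
definition in_H_space ::
    "real measure \<Rightarrow> (nat \<Rightarrow> real) \<Rightarrow> ereal \<Rightarrow> (nat set \<Rightarrow> ((nat \<Rightarrow> real) \<Rightarrow> real) set) \<Rightarrow>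
     (nat set \<Rightarrow> ((nat \<Rightarrow> real) \<Rightarrow> real) \<Rightarrow> ((nat \<Rightarrow> real) \<Rightarrow> real) \<Rightarrow> real) \<Rightarrow>
     ((nat \<Rightarrow> real) \<Rightarrow> real) \<Rightarrow> (nat set \<Rightarrow> (nat \<Rightarrow> real) \<Rightarrow> real) \<Rightarrow> bool" where
  "in_H_space \<mu> \<gamma> p H ip F Fu \<longleftrightarrow>
     (\<forall>u. finite u \<longrightarrow> Fu u \<in> H u) \<and>
     H_norm_finite \<gamma> p ip Fu \<and>
     F \<in> borel_measurable (\<Pi>\<^sub>M j\<in>UNIV. \<mu>) \<and>
     (AE y in (\<Pi>\<^sub>M j\<in>UNIV. \<mu>). ((\<lambda>u. Fu u (restrict y u)) has_sum F y) {u. finite u})"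

definition active_denominator ::
    "(nat \<Rightarrow> real) \<Rightarrow> real \<Rightarrow> ereal \<Rightarrow> ereal \<Rightarrow> real" where
  "active_denominator \<gamma> M q \<rho> =
     (if q = \<infinity> then (SUP v\<in>{v. finite v}. rpow (weight \<gamma> v * M ^ card v) (real_of_ereal (1 / \<rho>)))
      else (\<Sum>\<^sub>\<infinity>v\<in>{v. finite v}. rpow (weight \<gamma> v * M ^ card v) (real_of_ereal (q / \<rho>)))
             powr (1 / real_of_ereal q))"

definition active_set ::
    "(nat \<Rightarrow> real) \<Rightarrow> real \<Rightarrow> ereal \<Rightarrow> ereal \<Rightarrow> real \<Rightarrow> nat set set" where
  "active_set \<gamma> M q \<rho> \<epsilon> =
     {u. finite u \<and>
         rpow (weight \<gamma> u * M ^ card u) (1 - real_of_ereal (1 / \<rho>))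
           > (\<epsilon> / 2) / active_denominator \<gamma> M q \<rho>}"

definition error_weight ::
    "(nat \<Rightarrow> real) \<Rightarrow> (nat set \<Rightarrow> real) \<Rightarrow> real \<Rightarrow> real \<Rightarrow> nat set \<Rightarrow> real" where
  "error_weight \<gamma> C lam lam1 u =
     weight \<gamma> u * 2 powr lam * C u * rpow (real (card u)) (lam1 * real (card u))"

text \<open>
  Below, \<open>g u\<close> stands for \<open>error_weight \<gamma> C lam lam1 u\<close>,
  \<open>U\<close> for the active set, and \<open>cst d\<close> is the cost of one evaluation of a function of \<open>d\<close> variables.
\<close>
definition L_sum ::
    "(nat set \<Rightarrow> real) \<Rightarrow> (nat \<Rightarrow> real) \<Rightarrow> real \<Rightarrow> real \<Rightarrow> nat set set \<Rightarrow> real" where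
  "L_sum g cst q lam U =
     (\<Sum>u\<in>U. cst (card u) powr (q * lam / (q * lam + 1)) * g u powr (q / (q * lam + 1)))"

definition k_finite ::
    "(nat set \<Rightarrow> real) \<Rightarrow> (nat \<Rightarrow> real) \<Rightarrow> real \<Rightarrow> real \<Rightarrow> nat set set \<Rightarrow> real \<Rightarrow> nat set \<Rightarrow> real" where
  "k_finite g cst q lam U \<epsilon> u =
     (\<epsilon> / 2) powr (- 1 / lam)
       * (g u / cst (card u) powr (1 / q)) powr (q / (q * lam + 1))
       * L_sum g cst q lam U powr (1 / (q * lam))"

definition k_inf :: "(nat set \<Rightarrow> real) \<Rightarrow> real \<Rightarrow> real \<Rightarrow> nat set \<Rightarrow> real" where
  "k_inf g lam \<epsilon> u = (\<epsilon> / 2) powr (- 1 / lam) * g u powr (1 / lam)"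

definition k_choice ::
    "(nat set \<Rightarrow> real) \<Rightarrow> (nat \<Rightarrow> real) \<Rightarrow> ereal \<Rightarrow> real \<Rightarrow> nat set set \<Rightarrow> real \<Rightarrow> nat set \<Rightarrow> real" where
  "k_choice g cst q lam U \<epsilon> u =
     (if q = \<infinity> then k_inf g lam \<epsilon> u else k_finite g cst (real_of_ereal q) lam U \<epsilon> u)"

definition round_pow2 :: "real \<Rightarrow> nat" where
  "round_pow2 k = (if k \<ge> 1 then 2 ^ nat \<lfloor>log 2 k\<rfloor> else 0)"

text \<open>
  The weights and nodes of the \<open>n\<close>-point rule for \<open>u\<close> may depend on \<open>n\<close>.
\<close>
definition cubature ::
    "(nat set \<Rightarrow> nat \<Rightarrow> nat \<Rightarrow> real) \<Rightarrow> (nat set \<Rightarrow> nat \<Rightarrow> nat \<Rightarrow> nat \<Rightarrow> real) \<Rightarrow>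
     nat set \<Rightarrow> nat \<Rightarrow> ((nat \<Rightarrow> real) \<Rightarrow> real) \<Rightarrow> real" where
  "cubature w t u n f = (\<Sum>k<n. w u n k * f (t u n k))"

definition rate :: "real \<Rightarrow> real \<Rightarrow> nat \<Rightarrow> nat \<Rightarrow> real" where
  "rate lam lam1 d n =
     (if n = 0 then 1
      else max 1 (rpow (ln (real n)) (lam1 * real d)) / max 1 (real n powr lam))"

definition at_most_exponential :: "(nat set \<Rightarrow> real) \<Rightarrow> bool" where
  "at_most_exponential a \<longleftrightarrow> (\<exists>c>0. \<exists>T>0. \<forall>u. finite u \<longrightarrow> a u \<le> c * T ^ card u)"

definition mdm ::
    "(nat set \<Rightarrow> nat \<Rightarrow> nat \<Rightarrow> real) \<Rightarrow> (nat set \<Rightarrow> nat \<Rightarrow> nat \<Rightarrow> nat \<Rightarrow> real) \<Rightarrow>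
     nat set set \<Rightarrow> (nat set \<Rightarrow> nat) \<Rightarrow> (nat set \<Rightarrow> (nat \<Rightarrow> real) \<Rightarrow> real) \<Rightarrow> real" where
  "mdm w t U n Fu = (\<Sum>u\<in>U. cubature w t u (n u) (Fu u))"

definition mdm_cost :: "(nat \<Rightarrow> real) \<Rightarrow> nat set set \<Rightarrow> (nat set \<Rightarrow> nat) \<Rightarrow> real" where
  "mdm_cost cst U n = (\<Sum>u\<in>U. real (n u) * cst (card u))"

definition log_factor :: "real \<Rightarrow> nat set set \<Rightarrow> (nat set \<Rightarrow> nat) \<Rightarrow> real" where
  "log_factor lam1 U n =
     Max (insert 1 ((\<lambda>u. rpow (ln (real (n u)) / real (card u)) (lam1 * real (card u)))
                      ` {u\<in>U. u \<noteq> {} \<and> n u \<ge> 1}))"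

end

(*
  By Hoelder's inequality the error is at most the norm of F times the l^q-norm of the weighted
  errors in the single components. For an inactive u put t = gamma_u M_u; then
  t^q = (t^(1 - 1/rho))^q t^(q/rho), where the first factor is small and the second one summable,
  so that truncation costs at most epsilon/2. For the active u, k_u is chosen so that the
  cubature errors without logarithms have l^q-norm epsilon/2; the logarithms are absorbed by the factor
  |u|^(lambda_1 |u|) in k_u and by the log factor of the claim.

  With s = 1/(lambda + 1/q) >= p^*, the cost is controlled by a sum over u of terms bounded by a
  constant times Z^|u| |u|^(lambda_1 s |u|) prod_(j in u) gamma_j^s. The l-th elementary symmetric
  polynomial of a summable sequence with sum X is at most X^l / l!, and lambda_1 s < 1, so this sum
  is finite. The same factorial forces |u| = O(w / ln w) with w = ln(1/epsilon) for
  active u; since ln n_u = O(w), the log factor is exp(O(w ln ln w / ln w)).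
*)
theory Submission
  imports Defs "HOL-Real_Asymp.Real_Asymp"
begin

subsection \<open>Sums over finite sets of indices\<close>

text \<open>The formula for k_u comes from minimizing the sum of \<open>k u * cst (card u)\<close>
  under the constraint that the l^q-norm of \<open>g u * k u powr (- lam)\<close> is epsilon/2. A
  Lagrange multiplier makes k_u proportional to (g_u^q / cst)^(1/(q lam + 1)), and
  \<open>L_sum\<close> normalizes. At this choice the q-th powers of the errors and the costs are
  both proportional to the summands of \<open>L_sum\<close>, so one convergent series serves for
  both. Writing r = 1/q, with r = 0 for q = infinity, unifies the two formulas.

  The truncation estimate presupposes that I(F) is the sum of the I_u(F_u). Elements of H(K_u) come
  without measurability or integrability; the first is derived by approximation, the second from
  |f(y)| <= ||f|| K_u(y,y)^(1/2). Hoelder's inequality makes the sum of ||F_u|| M_u finite, and then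
  sum and integral may be exchanged although the series for F converges only almost everywhere.

  The exponent delta is obtained by solving epsilon^(-delta) = log factor, so it does not depend on
  F.\<close>

lemma rpow_nonneg: "rpow x a \<ge> 0"
  by (simp add: rpow_def)

text \<open>At \<open>x = 0\<close> the first factor vanishes because \<open>a > 0\<close>. The
  exponent \<open>b\<close> may be 0, which happens for rho = infinity; the convention 0^0 = 1 then
  makes the second factor 1.\<close>

lemma rpow_mult_complement:
  assumes "x \<ge> 0" "a > 0" "b \<ge> 0" "a + b = 1"
  shows "rpow x a * rpow x b = x"
  using assms by (cases "x = 0") (auto simp: rpow_def simp flip: powr_add)

lemma rpow_powr: "a \<noteq> 0 \<Longrightarrow> x \<ge> 0 \<Longrightarrow> rpow x y powr a = rpow x (y * a)"
  by (simp add: rpow_def powr_powr)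

text \<open>The left side consists of the first two terms of the binomial expansion; the others are
  nonnegative.\<close>

lemma power_Suc_add_ge:
  fixes a b :: real
  assumes "a \<ge> 0" "b \<ge> 0"
  shows "a ^ Suc l + real (Suc l) * b * a ^ l \<le> (a + b) ^ Suc l"
proof (induction l)
  case (Suc l)
  have "a ^ Suc (Suc l) + real (Suc (Suc l)) * b * a ^ Suc l
      \<le> (a + b) * (a ^ Suc l + real (Suc l) * b * a ^ l)"
    using assms by (simp add: algebra_simps)
  also have "\<dots> \<le> (a + b) * (a + b) ^ Suc l"
    using Suc assms by (intro mult_left_mono) auto
  finally show ?case by simp
qed simp

text \<open>In the multinomial expansion of the power every squarefree monomial of degree
  \<open>l\<close> occurs \<open>l\<close>! times. The proof uses instead the recursion e_(m+1)(A +
  b) = e_(m+1)(A) + x_b e_m(A) of the elementary symmetric polynomials.\<close>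

lemma sum_prod_card_le:
  fixes x :: "'a \<Rightarrow> real"
  assumes "finite A" "\<And>j. x j \<ge> 0"
  shows "(\<Sum>u | u \<subseteq> A \<and> card u = l. prod x u) \<le> (sum x A) ^ l / fact l"
  using assms(1)
proof (induction A arbitrary: l rule: finite_induct)
  case empty
  have "{u :: 'a set. u \<subseteq> {} \<and> card u = l} = (if l = 0 then {{}} else {})" by auto
  then show ?case by (cases "l = 0") (simp_all only: if_True if_False, simp_all)
next
  case (insert b A)
  show ?case
  proof (cases l)
    case 0
    have "{u. u \<subseteq> insert b A \<and> card u = 0} = {{}}"
      using finite_subset[of _ "insert b A"] insert.hyps(1) by fastforce
    then show ?thesis using 0 by simp
  next
    case (Suc m)
    let ?S = "\<lambda>m. {u. u \<subseteq> A \<and> card u = m}"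
    have fin: "finite (?S m)" for m using insert.hyps(1) by simp
    \<comment> \<open>The two parts are the subsets that avoid \<open>b\<close> and those that
      contain it.\<close>
    have "{u. u \<subseteq> insert b A \<and> card u = Suc m} = ?S (Suc m) \<union> insert b ` ?S m" (is "?L = ?R")
    proof (intro set_eqI iffI)
      fix u assume u: "u \<in> ?L"
      then have "finite u" using insert.hyps(1) finite_subset by auto
      show "u \<in> ?R"
      proof (cases "b \<in> u")
        case True
        then have "u = insert b (u - {b})" "u - {b} \<subseteq> A" "card (u - {b}) = m"
          using u \<open>finite u\<close> by auto
        then show ?thesis by blast
      qed (use u in auto)
    next
      fix u assume "u \<in> ?R"
      moreover have "card (insert b v) = Suc m" if "v \<in> ?S m" for v
        using that insert.hyps finite_subset[of v A] by (subst card_insert_disjoint) auto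
      ultimately show "u \<in> ?L" by auto
    qed
    then have "(\<Sum>u | u \<subseteq> insert b A \<and> card u = l. prod x u)
        = sum (prod x) (?S (Suc m)) + sum (prod x) (insert b ` ?S m)"
      unfolding Suc using fin insert.hyps by (subst sum.union_disjoint[symmetric]) auto
    also have "sum (prod x) (insert b ` ?S m) = (\<Sum>u\<in>?S m. prod x (insert b u))"
      using insert.hyps(2) by (subst sum.reindex) (auto simp: inj_on_def)
    also have "\<dots> = x b * sum (prod x) (?S m)"
      unfolding sum_distrib_left using insert.hyps
      by (intro sum.cong refl prod.insert) (auto dest: finite_subset)
    also have "sum (prod x) (?S (Suc m)) + x b * sum (prod x) (?S m)
        \<le> sum x A ^ Suc m / fact (Suc m) + x b * (sum x A ^ m / fact m)"
      using assms(2) by (intro add_mono mult_left_mono insert.IH) auto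
    also have "\<dots> = (sum x A ^ Suc m + real (Suc m) * x b * sum x A ^ m) / fact (Suc m)"
      by (simp add: divide_simps)
    also have "\<dots> \<le> (sum x A + x b) ^ Suc m / fact (Suc m)"
      using assms(2) by (intro divide_right_mono power_Suc_add_ge sum_nonneg) auto
    finally show ?thesis using insert.hyps Suc by (simp add: add.commute)
  qed
qed

text \<open>Over the index set \<open>u\<close> itself the symmetric polynomial of degree
  \<open>card u\<close> has a single term.\<close>

lemma prod_le_power_div_fact:
  fixes x :: "nat \<Rightarrow> real"
  assumes "finite u" "\<And>j. x j \<ge> 0" "summable x"
  shows "prod x u \<le> suminf x ^ card u / fact (card u)"
proof -
  have "{v. v \<subseteq> u \<and> card v = card u} = {u}"
    using assms(1) card_subset_eq by blast
  then have "prod x u \<le> sum x u ^ card u / fact (card u)"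
    using sum_prod_card_le[OF assms(1,2), where l = "card u"] by simp
  also have "\<dots> \<le> suminf x ^ card u / fact (card u)"
    using assms by (intro divide_right_mono power_mono sum_le_suminf sum_nonneg) auto
  finally show ?thesis .
qed

text \<open>A finite family of finite sets lies in the power set of its union. Grouping that power
  set by cardinality produces elementary symmetric polynomials, whose bounds do not depend on the
  family.\<close>

lemma summable_on_card_times_prod:
  fixes x :: "nat \<Rightarrow> real" and h :: "nat \<Rightarrow> real"
  assumes x: "\<And>j. x j \<ge> 0" "summable x" and h: "\<And>l. h l \<ge> 0"
    and sm: "summable (\<lambda>l. h l * suminf x ^ l / fact l)"
  shows "(\<lambda>u. h (card u) * prod x u) summable_on {u. finite u}"
proof (rule nonneg_bdd_above_summable_on)
  fix u show "0 \<le> h (card u) * prod x u" using x h by (simp add: prod_nonneg)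
next
  show "bdd_above (sum (\<lambda>u. h (card u) * prod x u) ` {F. F \<subseteq> {u. finite u} \<and> finite F})"
  proof (rule bdd_aboveI2)
    fix T assume "T \<in> {F. F \<subseteq> {u::nat set. finite u} \<and> finite F}"
    then have T: "finite T" "\<And>u. u \<in> T \<Longrightarrow> finite u" by auto
    define A where "A = \<Union> T"
    have A: "finite A" unfolding A_def using T by auto
    have "(\<Sum>u\<in>T. h (card u) * prod x u) \<le> (\<Sum>u\<in>Pow A. h (card u) * prod x u)"
      using x h A by (intro sum_mono2) (auto simp: A_def prod_nonneg)
    also have "\<dots> = (\<Sum>l\<le>card A. \<Sum>u | u \<in> Pow A \<and> card u = l. h (card u) * prod x u)"
      using A by (intro sum.group[symmetric]) (auto intro: card_mono)
    also have "\<dots> = (\<Sum>l\<le>card A. h l * (\<Sum>u | u \<subseteq> A \<and> card u = l. prod x u))"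
      by (intro sum.cong refl) (simp add: sum_distrib_left)
    also have "\<dots> \<le> (\<Sum>l\<le>card A. h l * (suminf x ^ l / fact l))"
    proof (intro sum_mono mult_left_mono h)
      fix l
      have "(\<Sum>u | u \<subseteq> A \<and> card u = l. prod x u) \<le> sum x A ^ l / fact l"
        using x A by (intro sum_prod_card_le) auto
      also have "\<dots> \<le> suminf x ^ l / fact l"
        using x A by (intro divide_right_mono power_mono sum_le_suminf sum_nonneg) auto
      finally show "(\<Sum>u | u \<subseteq> A \<and> card u = l. prod x u) \<le> suminf x ^ l / fact l" .
    qed
    also have "\<dots> \<le> (\<Sum>l. h l * suminf x ^ l / fact l)"
      using h x sm by (simp add: sum_le_suminf suminf_nonneg)
    finally show "(\<Sum>u\<in>T. h (card u) * prod x u) \<le> (\<Sum>l. h l * suminf x ^ l / fact l)" .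
  qed
qed

text \<open>l^l / l! is one term of the exponential series at l.\<close>

lemma power_self_le_fact: "real l ^ l \<le> exp (real l) * fact l"
proof -
  have "(\<Sum>n\<in>{l}. real l ^ n /\<^sub>R fact n) \<le> (\<Sum>n. real l ^ n /\<^sub>R fact n)"
    by (intro sum_le_suminf summable_exp_generic) auto
  then show ?thesis by (simp add: exp_def field_simps)
qed

text \<open>The ratio of consecutive terms is Z / (l+1)^b, which tends to 0 however small
  \<open>b\<close> is.\<close>

lemma summable_power_div_fact_powr:
  fixes Z b :: real
  assumes "Z \<ge> 0" "b > 0"
  shows "summable (\<lambda>l. Z ^ l / fact l powr b)"
proof -
  have "((\<lambda>l. Z / real (Suc l) powr b) \<longlongrightarrow> 0) sequentially"
    using assms by real_asymp
  then have "eventually (\<lambda>l. Z / real (Suc l) powr b < 1/2) sequentially"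
    by (rule order_tendstoD) simp
  then obtain N where N: "\<And>l. l \<ge> N \<Longrightarrow> Z / real (Suc l) powr b < 1/2"
    by (auto simp: eventually_sequentially)
  show ?thesis
  proof (rule summable_ratio_test[of "1/2" N])
    fix l assume "l \<ge> N"
    have "Z ^ Suc l / fact (Suc l) powr b = Z / real (Suc l) powr b * (Z ^ l / fact l powr b)"
      by (simp add: powr_mult del: of_nat_Suc)
    also have "\<dots> \<le> 1/2 * (Z ^ l / fact l powr b)"
      using N[OF \<open>l \<ge> N\<close>] assms by (intro mult_right_mono) auto
    finally show "norm (Z ^ Suc l / fact (Suc l) powr b) \<le> 1/2 * norm (Z ^ l / fact l powr b)"
      using assms by simp
  qed simp
qed

lemma rpow_card_le_fact:
  assumes "a \<ge> 0"
  shows "rpow (real l) (a * real l) \<le> exp a ^ l * fact l powr a"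
proof (cases "a * real l = 0")
  case True
  then show ?thesis using assms by (auto simp: rpow_def)
next
  case False
  have "real l powr (a * real l) = (real l ^ l) powr a"
    using False by (simp add: powr_powr mult.commute flip: powr_realpow)
  also have "\<dots> \<le> (exp (real l) * fact l) powr a"
    using assms by (intro powr_mono2 power_self_le_fact) auto
  also have "\<dots> = exp a ^ l * fact l powr a"
    by (simp add: powr_mult exp_powr_real flip: exp_of_nat2_mult)
  finally show ?thesis using False by (simp add: rpow_def)
qed

text \<open>Since l^l <= e^l l!, the superexponential factor costs only (l!)^a, and (l!)^(1-a) stays
  in the denominator.\<close>

lemma summable_card_growth:
  fixes Z X a :: real
  assumes "Z \<ge> 0" "X \<ge> 0" "0 \<le> a" "a < 1"
  shows "summable (\<lambda>l. Z ^ l * rpow (real l) (a * real l) * X ^ l / fact l)"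
proof (rule summable_comparison_test')
  show "summable (\<lambda>l. (Z * exp a * X) ^ l / fact l powr (1 - a))"
    using assms by (intro summable_power_div_fact_powr) auto
  fix l :: nat
  have "Z ^ l * rpow (real l) (a * real l) * X ^ l / fact l
      \<le> Z ^ l * (exp a ^ l * fact l powr a) * X ^ l / fact l"
    using assms by (intro divide_right_mono mult_right_mono mult_left_mono rpow_card_le_fact) auto
  also have "\<dots> = (Z * exp a * X) ^ l / fact l powr (1 - a)"
    by (simp add: powr_diff power_mult_distrib field_simps)
  finally show "norm (Z ^ l * rpow (real l) (a * real l) * X ^ l / fact l)
      \<le> (Z * exp a * X) ^ l / fact l powr (1 - a)"
    using assms by (simp add: rpow_def)
qed

text \<open>All but finitely many terms are below 1, where raising the exponent decreases the
  power.\<close>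

lemma summable_powr_larger:
  fixes \<gamma> :: "nat \<Rightarrow> real"
  assumes "summable (\<lambda>j. \<gamma> j powr r)" "\<And>j. \<gamma> j > 0" "0 < r" "r \<le> s"
  shows "summable (\<lambda>j. \<gamma> j powr s)"
proof (rule summable_comparison_test_ev[OF _ assms(1)])
  have "(\<lambda>j. \<gamma> j powr r) \<longlonglongrightarrow> 0" by (rule summable_LIMSEQ_zero[OF assms(1)])
  then have "eventually (\<lambda>j. \<gamma> j powr r < 1) sequentially"
    by (rule order_tendstoD) simp
  then show "eventually (\<lambda>j. norm (\<gamma> j powr s) \<le> \<gamma> j powr r) sequentially"
  proof eventually_elim
    case (elim j)
    then have "\<gamma> j < 1"
      using assms(2)[of j] assms(3) ge_one_powr_ge_zero[of "\<gamma> j" r] by linarith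
    then show ?case using assms(2)[of j] assms(4) powr_mono'[where a = r and b = s and x = "\<gamma> j"] by simp
  qed
qed

lemma weight_powr: "weight \<gamma> u powr s = (\<Prod>j\<in>u. \<gamma> j powr s)"
  by (simp add: weight_def prod_powr_distrib)

lemma weight_pos: "(\<And>j. \<gamma> j > 0) \<Longrightarrow> weight \<gamma> u > 0"
  by (simp add: weight_def prod_pos)

text \<open>Applied with \<open>a = 0\<close> to the powers of gamma_u M_u, and with
  \<open>a = lam1 * s\<close> to the terms of the cost.\<close>

lemma summable_on_weight:
  fixes \<gamma> :: "nat \<Rightarrow> real"
  assumes "summable (\<lambda>j. \<gamma> j powr r)" "\<And>j. \<gamma> j > 0" "0 < r" "r \<le> s" "Z \<ge> 0" "0 \<le> a" "a < 1"
  shows "(\<lambda>u. Z ^ card u * rpow (real (card u)) (a * real (card u)) * weight \<gamma> u powr s)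
           summable_on {u. finite u}"
proof -
  have s: "summable (\<lambda>j. \<gamma> j powr s)" using assms(1-4) by (rule summable_powr_larger)
  show ?thesis
    unfolding weight_powr
    by (rule summable_on_card_times_prod[where h = "\<lambda>l. Z ^ l * rpow (real l) (a * real l)"])
       (use assms s in \<open>auto intro!: summable_card_growth suminf_nonneg mult_nonneg_nonneg rpow_nonneg\<close>)
qed

subsection \<open>Hoelder's inequality for the weighted norm\<close>

text \<open>Young's inequality is summed over the normalized terms a_i / A and b_i / B. If
  \<open>A\<close> or \<open>B\<close> is 0, the corresponding terms all vanish. Arbitrary upper
  bounds in place of the two norms allow finite partial sums to be compared with the norm of an
  infinite family.\<close>

lemma Hoelder_sum_le:
  fixes p q A B :: real
  assumes pq: "p > 1" "q > 1" "1 / p + 1 / q = 1"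
    and nonneg: "\<And>i. i \<in> S \<Longrightarrow> a i \<ge> 0" "\<And>i. i \<in> S \<Longrightarrow> b i \<ge> 0" "A \<ge> 0" "B \<ge> 0"
    and "finite S" and a: "(\<Sum>i\<in>S. a i powr p) \<le> A powr p" and b: "(\<Sum>i\<in>S. b i powr q) \<le> B powr q"
  shows "(\<Sum>i\<in>S. a i * b i) \<le> A * B"
proof -
  have zero: "\<forall>i\<in>S. c i = 0" if "(\<Sum>i\<in>S. c i powr r) \<le> 0" for c :: "'a \<Rightarrow> real" and r
    using that sum_nonneg_eq_0_iff[of S "\<lambda>i. c i powr r"] \<open>finite S\<close>
    by (simp add: order.antisym sum_nonneg)
  consider "A = 0" | "B = 0" | "A > 0" "B > 0" using nonneg by linarith
  then show ?thesis
  proof cases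
    case 1
    then show ?thesis using zero[of a p] a by simp
  next
    case 2
    then show ?thesis using zero[of b q] b by simp
  next
    case 3
    have "(\<Sum>i\<in>S. (a i / A) * (b i / B)) \<le> (\<Sum>i\<in>S. (a i / A) powr p / p + (b i / B) powr q / q)"
      using pq nonneg 3 by (intro sum_mono Youngs_inequality) auto
    also have "\<dots> = (\<Sum>i\<in>S. a i powr p) / A powr p / p + (\<Sum>i\<in>S. b i powr q) / B powr q / q"
      using nonneg 3 by (simp add: powr_divide sum.distrib sum_divide_distrib)
    also have "\<dots> \<le> 1 / p + 1 / q"
      using pq a b 3 by (intro add_mono divide_right_mono) (auto simp: divide_le_eq)
    finally have "(\<Sum>i\<in>S. a i * b i) / (A * B) \<le> 1"
      using pq by (simp add: sum_divide_distrib)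
    then show ?thesis using 3 by (simp add: divide_le_eq)
  qed
qed

lemma conjugate_exponents_cases:
  fixes p q :: ereal
  assumes "1 \<le> p" "1 \<le> q" "1 / p + 1 / q = 1"
  obtains "p = 1" "q = \<infinity>" | "p = \<infinity>" "q = 1"
    | p' q' where "p = ereal p'" "q = ereal q'" "p' > 1" "q' > 1" "1 / p' + 1 / q' = 1"
proof (cases p)
  case (real p')
  note P = this
  show ?thesis
  proof (cases q)
    case (real q')
    have "p' \<ge> 1" "q' \<ge> 1" using P real assms by (auto simp: one_ereal_def)
    moreover have "1 / p' + 1 / q' = 1"
      using P real assms calculation by (simp add: one_ereal_def divide_ereal_def)
         (simp add: inverse_eq_divide)
    moreover from calculation have "p' \<noteq> 1" "q' \<noteq> 1" by auto
    ultimately show ?thesis using that(3)[of p' q'] P real by auto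
  next
    case PInf
    then have "p' = 1" using P assms by (auto simp: one_ereal_def divide_ereal_def split: if_splits)
    then show ?thesis using that(1) P PInf by (auto simp: one_ereal_def)
  qed (use assms in auto)
next
  case PInf
  then have "1 / q = 1" using assms by simp
  moreover have "q \<noteq> 0" using assms by auto
  ultimately have "q = 1" using assms
    by (cases q) (auto simp: one_ereal_def divide_ereal_def split: if_splits)
  then show ?thesis using that(2) PInf by simp
qed (use assms in auto)

text \<open>For nonnegative \<open>b\<close> and \<open>B\<close> this bounds the l^q-norm over
  \<open>S\<close>. Comparing q-th powers avoids taking roots of partial sums.\<close>

definition lq_bounded :: "ereal \<Rightarrow> ('a \<Rightarrow> real) \<Rightarrow> 'a set \<Rightarrow> real \<Rightarrow> bool" where
  "lq_bounded q b S B \<longleftrightarrow>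
     (if q = \<infinity> then \<forall>u\<in>S. b u \<le> B
      else (\<Sum>u\<in>S. b u powr real_of_ereal q) \<le> B powr real_of_ereal q)"

text \<open>The factor gamma_u is moved from one side of the pairing to the other: its inverse
  enters the norm of F, and gamma_u itself multiplies \<open>b\<close>. Infinite sums are reached
  later through bounds uniform in the finite set \<open>S\<close>.\<close>

lemma sum_ip_norm_le_H_norm:
  assumes pq: "1 \<le> p" "1 \<le> q" "1 / p + 1 / q = 1"
    and gamma_pos: "\<And>j. \<gamma> j > 0"
    and S: "finite S" "\<And>u. u \<in> S \<Longrightarrow> finite u"
    and ip: "\<And>u. finite u \<Longrightarrow> ip_norm (ip u) (Fu u) \<ge> 0"
    and fin: "H_norm_finite \<gamma> p ip Fu"
    and b: "\<And>u. u \<in> S \<Longrightarrow> b u \<ge> 0" "B \<ge> 0" "lq_bounded q (\<lambda>u. weight \<gamma> u * b u) S B"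
  shows "(\<Sum>u\<in>S. ip_norm (ip u) (Fu u) * b u) \<le> H_norm \<gamma> p ip Fu * B"
proof -
  let ?a = "scaled_norm \<gamma> ip Fu" and ?c = "\<lambda>u. weight \<gamma> u * b u" and ?N = "H_norm \<gamma> p ip Fu"
  have w: "weight \<gamma> u > 0" for u using gamma_pos by (rule weight_pos)
  have a: "?a u \<ge> 0" if "finite u" for u
    using that ip w[of u] by (simp add: scaled_norm_def)
  have c: "?c u \<ge> 0" if "u \<in> S" for u using that b(1) w[of u] by simp
  have eq: "(\<Sum>u\<in>S. ip_norm (ip u) (Fu u) * b u) = (\<Sum>u\<in>S. ?a u * ?c u)"
  proof (intro sum.cong refl)
    fix u show "ip_norm (ip u) (Fu u) * b u = ?a u * ?c u"
      using w[of u] by (simp add: scaled_norm_def)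
  qed
  have p_fin: "(\<Sum>u\<in>S. ?a u powr r) \<le> ?N powr r" if "p = ereal r" "r \<ge> 1" for r
  proof -
    have sm: "(\<lambda>u. ?a u powr r) summable_on {u. finite u}"
      using fin that by (simp add: H_norm_finite_def)
    have "(\<Sum>u\<in>S. ?a u powr r) \<le> (\<Sum>\<^sub>\<infinity>u\<in>{u. finite u}. ?a u powr r)"
      using S by (intro finite_sum_le_infsum[OF sm]) auto
    also have "\<dots> = ?N powr r"
      using that infsum_nonneg[of "{u. finite u}" "\<lambda>u. ?a u powr r"]
      by (simp add: H_norm_def powr_powr)
    finally show ?thesis .
  qed
  from pq show ?thesis
  proof (cases rule: conjugate_exponents_cases)
    case 1
    then have cB: "?c u \<le> B" if "u \<in> S" for u using b(3) that by (simp add: lq_bounded_def)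
    have "(\<Sum>u\<in>S. ?a u * ?c u) \<le> (\<Sum>u\<in>S. ?a u * B)"
      using cB a S by (intro sum_mono mult_left_mono) auto
    also have "\<dots> = (\<Sum>u\<in>S. ?a u powr 1) * B"
      unfolding sum_distrib_right using a S by (intro sum.cong) auto
    also have "\<dots> \<le> ?N powr 1 * B"
      using p_fin[of 1] 1 b by (intro mult_right_mono) (auto simp: one_ereal_def)
    also have "\<dots> = ?N * B"
      using 1 by (simp add: H_norm_def)
    finally show ?thesis using eq by simp
  next
    case 2
    have bdd: "bdd_above (?a ` {u. finite u})" using fin 2 by (simp add: H_norm_finite_def)
    have aN: "?a u \<le> ?N" if "finite u" for u
      using cSUP_upper[OF _ bdd] that 2 by (simp add: H_norm_def)
    then have "?N \<ge> 0" using a[of "{}"] order_trans[of 0 "?a {}" ?N] by simp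
    have "(\<Sum>u\<in>S. ?a u * ?c u) \<le> (\<Sum>u\<in>S. ?N * ?c u)"
      using aN c S by (intro sum_mono mult_right_mono) auto
    also have "\<dots> = ?N * (\<Sum>u\<in>S. ?c u powr 1)"
      unfolding sum_distrib_left using c by (intro sum.cong) auto
    also have "\<dots> \<le> ?N * B"
      using b 2 \<open>?N \<ge> 0\<close> by (intro mult_left_mono) (auto simp: lq_bounded_def)
    finally show ?thesis using eq by simp
  next
    case (3 p' q')
    have "(\<Sum>u\<in>S. ?a u * ?c u) \<le> ?N * B"
    proof (rule Hoelder_sum_le[OF 3(3,4,5)])
      show "(\<Sum>u\<in>S. ?a u powr p') \<le> ?N powr p'" using p_fin 3 by simp
      show "(\<Sum>u\<in>S. ?c u powr q') \<le> B powr q'" using b(3) 3 by (simp add: lq_bounded_def)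
      show "?N \<ge> 0" using 3 by (simp add: H_norm_def)
    qed (use a c S b in auto)
    then show ?thesis using eq by simp
  qed
qed

lemma lq_bounded_mult_le:
  assumes "1 \<le> q" "lq_bounded q f S B" "B \<ge> 0" "c \<ge> 0"
    and "\<And>u. u \<in> S \<Longrightarrow> 0 \<le> h u" "\<And>u. u \<in> S \<Longrightarrow> 0 \<le> f u" "\<And>u. u \<in> S \<Longrightarrow> h u \<le> c * f u"
  shows "lq_bounded q h S (c * B)"
proof (cases "q = \<infinity>")
  case True
  have "h u \<le> c * B" if "u \<in> S" for u
    using that assms True by (intro order_trans[OF assms(7)[OF that]] mult_left_mono) (auto simp: lq_bounded_def)
  then show ?thesis using True by (simp add: lq_bounded_def)
next
  case False
  let ?q = "real_of_ereal q"
  have q: "?q \<ge> 0" using assms(1) False by (cases q) (auto simp: one_ereal_def)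
  have "(\<Sum>u\<in>S. h u powr ?q) \<le> (\<Sum>u\<in>S. (c * f u) powr ?q)"
    using assms q by (intro sum_mono powr_mono2) auto
  also have "\<dots> = c powr ?q * (\<Sum>u\<in>S. f u powr ?q)"
    by (simp add: powr_mult sum_distrib_left)
  also have "\<dots> \<le> c powr ?q * B powr ?q"
    using assms(2) False by (intro mult_left_mono) (auto simp: lq_bounded_def)
  finally show ?thesis using False by (simp add: lq_bounded_def powr_mult)
qed

subsection \<open>Reproducing kernel Hilbert spaces\<close>

text \<open>The coefficient lets one shape serve both for plain differences (hence the terms
  \<open>1 * v x\<close> below) and for perturbations by multiples of kernel sections.\<close>

lemma (in rkhs) diff_scale_mem:
  assumes "f \<in> H" "g \<in> H"
  shows "(\<lambda>x. f x - c * g x) \<in> H"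
  using add_mem[OF assms(1) scale_mem[OF assms(2), of "- c"]] by simp

lemma (in rkhs) ip_diff_scale_right:
  assumes "f \<in> H" "g \<in> H" "h \<in> H"
  shows "ip (\<lambda>x. f x - c * g x) h = ip f h - c * ip g h"
  using ip_add[OF assms(1) scale_mem[OF assms(2), of "- c"] assms(3)]
    ip_scale[OF assms(2,3), of "- c"] by simp

lemma (in rkhs) ip_diff_scale:
  assumes "f \<in> H" "g \<in> H"
  shows "ip (\<lambda>x. f x - c * g x) (\<lambda>x. f x - c * g x) = ip f f - 2 * c * ip f g + c\<^sup>2 * ip g g"
proof -
  let ?h = "\<lambda>x. f x - c * g x"
  note m = diff_scale_mem[OF assms, of c]
  have "ip ?h ?h = ip f ?h - c * ip g ?h" using ip_diff_scale_right[OF assms m] .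
  also have "ip f ?h = ip f f - c * ip f g"
    using ip_diff_scale_right[OF assms assms(1), of c] ip_commute[OF m assms(1)] ip_commute[OF assms] by simp
  also have "ip g ?h = ip f g - c * ip g g"
    using ip_diff_scale_right[OF assms assms(2), of c] ip_commute[OF m assms(2)] by simp
  finally show ?thesis by (simp add: algebra_simps power2_eq_square)
qed

lemma (in rkhs) ip_section_section: "y \<in> X \<Longrightarrow> ip (kernel_section X K y) (kernel_section X K y) = K y y"
  using reproducing[OF section_mem] by (simp add: kernel_section_def)

lemma (in rkhs) ip_norm_nonneg: "f \<in> H \<Longrightarrow> ip_norm ip f \<ge> 0"
  using ip_nonneg by (simp add: ip_norm_def)

text \<open>This is Cauchy-Schwarz for \<open>f\<close> and the kernel section at \<open>y\<close>,
  obtained from the nonnegativity of the squared norm of their combination as a quadratic in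
  \<open>c\<close>.\<close>

lemma (in rkhs) abs_eval_le:
  assumes f: "f \<in> H" and y: "y \<in> X"
  shows "\<bar>f y\<bar> \<le> ip_norm ip f * sqrt (K y y)"
proof -
  have quad: "0 \<le> ip f f - 2 * c * f y + c\<^sup>2 * K y y" for c
    using ip_diff_scale[OF f section_mem[OF y], of c] reproducing[OF f y] ip_section_section[OF y]
      ip_nonneg[OF diff_scale_mem[OF f section_mem[OF y]], of c] by simp
  have "K y y \<ge> 0" using ip_nonneg[OF section_mem[OF y]] ip_section_section[OF y] by simp
  have "(f y)\<^sup>2 \<le> ip f f * K y y"
  proof (cases "K y y = 0")
    case True
    \<comment> \<open>Here the quadratic degenerates to a linear function of \<open>c\<close>; for
      \<open>f y\<close> nonzero the chosen \<open>c\<close> would give it the value -1.\<close>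
    have "f y = 0"
      using quad[of "(ip f f + 1) / (2 * f y)"] True by (cases "f y = 0") auto
    then show ?thesis using True by simp
  next
    case False
    then show ?thesis
      using quad[of "f y / K y y"] \<open>K y y \<ge> 0\<close> by (simp add: field_simps power2_eq_square)
  qed
  then have "sqrt ((f y)\<^sup>2) \<le> sqrt (ip f f * K y y)" by (rule real_sqrt_le_mono)
  then show ?thesis by (simp add: ip_norm_def real_sqrt_mult)
qed

text \<open>
  The distance of \<open>f\<close> to the subspace of measurable functions in \<open>H\<close> is almost attained along a
  minimizing sequence; perturbing it by multiples of kernel sections shows that the sequence
  converges to \<open>f\<close> pointwise. Neither completeness nor a projection is needed.
\<close>
lemma (in rkhs) measurable_of_sections:
  assumes N: "space N = X"
    and sections: "\<And>y. y \<in> X \<Longrightarrow> kernel_section X K y \<in> borel_measurable N"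
    and f: "f \<in> H"
  shows "f \<in> borel_measurable N"
proof -
  define V where "V = {v\<in>H. v \<in> borel_measurable N}"
  define D where "D = (\<lambda>v. ip (\<lambda>x. f x - 1 * v x) (\<lambda>x. f x - 1 * v x)) ` V"
  have "(\<lambda>x. 0) \<in> V" using zero_mem by (simp add: V_def)
  then have D: "D \<noteq> {}" "bdd_below D"
    unfolding D_def V_def
    using ip_nonneg[OF diff_scale_mem[OF f, of _ 1]] by (auto intro!: bdd_belowI[of _ 0])
  have "\<exists>v\<in>V. ip (\<lambda>x. f x - 1 * v x) (\<lambda>x. f x - 1 * v x) < Inf D + inverse (real (Suc i))" for i
    using cInf_lessD[OF D(1), of "Inf D + inverse (real (Suc i))"] by (auto simp: D_def)
  then obtain v where v: "\<And>i. v i \<in> V"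
    "\<And>i. ip (\<lambda>x. f x - 1 * v i x) (\<lambda>x. f x - 1 * v i x) < Inf D + inverse (real (Suc i))"
    by metis
  have lim: "(\<lambda>i. v i y) \<longlonglongrightarrow> f y" if y: "y \<in> X" for y
  proof -
    let ?k = "kernel_section X K y"
    have K: "K y y \<ge> 0" using ip_nonneg[OF section_mem[OF y]] ip_section_section[OF y] by simp
    have bound: "(f y - v i y)\<^sup>2 \<le> (K y y + 1) * inverse (real (Suc i))" for i
    proof -
      let ?h = "\<lambda>x. f x - 1 * v i x"
      \<comment> \<open>The optimal coefficient has \<open>K y y\<close> in the denominator, which
        may be 0. With \<open>K y y + 1\<close> instead, the squared distance still drops by c^2
        (K(y,y) + 2).\<close>
      define c where "c = (f y - v i y) / (K y y + 1)"
      have vH: "v i \<in> H" using v(1) by (simp add: V_def)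
      have hH: "?h \<in> H" using diff_scale_mem[OF f vH] .
      \<comment> \<open>The perturbed function is still measurable, so its squared distance to
        \<open>f\<close> cannot fall below \<open>Inf D\<close>; hence the drop is at most the slack
        of \<open>v i\<close>.\<close>
      have "(\<lambda>x. v i x - (- c) * ?k x) \<in> V"
        using v(1)[of i] diff_scale_mem[OF vH section_mem[OF y], of "- c"] sections[OF y]
        by (auto simp: V_def)
      then have "ip (\<lambda>x. f x - 1 * (v i x - (- c) * ?k x)) (\<lambda>x. f x - 1 * (v i x - (- c) * ?k x)) \<in> D"
        unfolding D_def by (rule imageI)
      then have "Inf D \<le> ip (\<lambda>x. ?h x - c * ?k x) (\<lambda>x. ?h x - c * ?k x)"
        using cInf_lower[OF _ D(2)] by (simp add: algebra_simps)
      also have "\<dots> = ip ?h ?h - 2 * c * (f y - v i y) + c\<^sup>2 * K y y"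
        using ip_diff_scale[OF hH section_mem[OF y], of c] reproducing[OF hH y]
          ip_section_section[OF y] by simp
      also have "\<dots> < Inf D + inverse (real (Suc i)) - 2 * c * (f y - v i y) + c\<^sup>2 * K y y"
        using v(2)[of i] by simp
      finally have "2 * c * (f y - v i y) - c\<^sup>2 * K y y \<le> inverse (real (Suc i))" by simp
      moreover have "f y - v i y = c * (K y y + 1)" using K by (simp add: c_def)
      ultimately have "c\<^sup>2 * (K y y + 2) \<le> inverse (real (Suc i))"
        by (simp only:) (simp add: algebra_simps power2_eq_square)
      then have "c\<^sup>2 * (K y y + 1) \<le> inverse (real (Suc i))"
        using mult_left_mono[of "K y y + 1" "K y y + 2" "c\<^sup>2"] by (simp del: of_nat_Suc)
      then have "(K y y + 1) * (c\<^sup>2 * (K y y + 1)) \<le> (K y y + 1) * inverse (real (Suc i))"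
        using K by (intro mult_left_mono) auto
      moreover have "(f y - v i y)\<^sup>2 = (K y y + 1) * (c\<^sup>2 * (K y y + 1))"
        using \<open>f y - v i y = _\<close> by (simp only:) (simp add: power2_eq_square algebra_simps)
      ultimately show ?thesis by simp
    qed
    have "(\<lambda>i. (K y y + 1) * inverse (real (Suc i))) \<longlonglongrightarrow> (K y y + 1) * 0"
      by (intro tendsto_mult tendsto_const LIMSEQ_inverse_real_of_nat)
    then have "(\<lambda>i. (K y y + 1) * inverse (real (Suc i))) \<longlonglongrightarrow> 0" by (simp only: mult_zero_right)
    then have "(\<lambda>i. (f y - v i y)\<^sup>2) \<longlonglongrightarrow> 0"
      by (rule Lim_null_comparison[rotated]) (simp add: bound del: of_nat_Suc)
    then have "(\<lambda>i. sqrt ((f y - v i y)\<^sup>2)) \<longlonglongrightarrow> sqrt 0" by (rule tendsto_real_sqrt)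
    then have "(\<lambda>i. f y - v i y) \<longlonglongrightarrow> 0" by (simp add: tendsto_rabs_zero_iff)
    then have "(\<lambda>i. f y - (f y - v i y)) \<longlonglongrightarrow> f y - 0" by (intro tendsto_diff tendsto_const)
    then show ?thesis by simp
  qed
  show ?thesis
  proof (rule borel_measurable_LIMSEQ_real)
    show "v i \<in> borel_measurable N" for i using v(1) by (simp add: V_def)
    show "(\<lambda>i. v i x) \<longlonglongrightarrow> f x" if "x \<in> space N" for x using lim that N by simp
  qed
qed

subsection \<open>Integrals of the components\<close>

lemma abs_has_sum_le:
  fixes f :: "'a \<Rightarrow> real"
  assumes "(f has_sum x) A" "\<And>T. finite T \<Longrightarrow> T \<subseteq> A \<Longrightarrow> \<bar>sum f T\<bar> \<le> B"
  shows "\<bar>x\<bar> \<le> B"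
proof (rule tendsto_upperbound)
  show "((\<lambda>T. \<bar>sum f T\<bar>) \<longlongrightarrow> \<bar>x\<bar>) (finite_subsets_at_top A)"
    using assms(1) unfolding has_sum_def by (rule tendsto_rabs)
  show "eventually (\<lambda>T. \<bar>sum f T\<bar> \<le> B) (finite_subsets_at_top A)"
    using assms(2) by (rule eventually_finite_subsets_at_top_weakI)
qed simp

text \<open>This locale holds the analysis of the components; the weights and exponents are treated
  in \<open>mdm_weights\<close>, which sees \<open>M\<close> only as a nonnegative number.\<close>

locale product_rkhs_setting = prob_space \<mu> for \<mu> :: "real measure" +
  fixes K :: "real \<Rightarrow> real \<Rightarrow> real"
    and M :: real
    and H :: "nat set \<Rightarrow> ((nat \<Rightarrow> real) \<Rightarrow> real) set"
    and ip :: "nat set \<Rightarrow> ((nat \<Rightarrow> real) \<Rightarrow> real) \<Rightarrow> ((nat \<Rightarrow> real) \<Rightarrow> real) \<Rightarrow> real"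
  assumes kernel: "reproducing_kernel_on (space \<mu>) K"
    and kernel_measurable: "\<And>y. y \<in> space \<mu> \<Longrightarrow> (\<lambda>x. K x y) \<in> borel_measurable \<mu>"
    and kernel_integrable: "integrable \<mu> (\<lambda>y. sqrt (K y y))"
    and M_eq: "M = (LINT y|\<mu>. sqrt (K y y))"
    and spaces: "\<And>u. finite u \<Longrightarrow> rkhs (u \<rightarrow>\<^sub>E space \<mu>) (product_kernel K u) (H u) (ip u)"
begin

lemma kernel_diag_nonneg: "y \<in> space \<mu> \<Longrightarrow> K y y \<ge> 0"
proof -
  assume y: "y \<in> space \<mu>"
  have "\<forall>S c. finite S \<and> S \<subseteq> space \<mu> \<longrightarrow> 0 \<le> (\<Sum>x\<in>S. \<Sum>y\<in>S. c x * c y * K x y)"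
    using kernel unfolding reproducing_kernel_on_def by (rule conjunct2)
  from this[rule_format, of "{y}" "\<lambda>_. 1"] y show ?thesis by simp
qed

lemma M_nonneg: "M \<ge> 0"
  unfolding M_eq
  by (rule integral_nonneg_AE, rule AE_I2) (simp add: kernel_diag_nonneg)

sublocale product_prob_space "\<lambda>_. \<mu>" "UNIV :: nat set"
  by unfold_locales

text \<open>The kernel sections are finite products of measurable functions of one coordinate, and
  measurability passes from the sections to the whole space.\<close>

lemma measurable_component:
  assumes u: "finite u" and f: "f \<in> H u"
  shows "f \<in> borel_measurable (Pi\<^sub>M u (\<lambda>_. \<mu>))"
proof -
  interpret rkhs "u \<rightarrow>\<^sub>E space \<mu>" "product_kernel K u" "H u" "ip u" using u by (rule spaces)
  show ?thesis
  proof (rule measurable_of_sections[OF _ _ f])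
    show "space (Pi\<^sub>M u (\<lambda>_. \<mu>)) = u \<rightarrow>\<^sub>E space \<mu>" by (simp add: space_PiM)
    fix y assume y: "y \<in> u \<rightarrow>\<^sub>E space \<mu>"
    have "(\<lambda>x. \<Prod>j\<in>u. K (x j) (y j)) \<in> borel_measurable (Pi\<^sub>M u (\<lambda>_. \<mu>))"
    proof (rule borel_measurable_prod)
      fix j assume j: "j \<in> u"
      have "(\<lambda>x. K x (y j)) \<in> borel_measurable \<mu>"
        using y j by (intro kernel_measurable) auto
      then show "(\<lambda>x. K (x j) (y j)) \<in> borel_measurable (Pi\<^sub>M u (\<lambda>_. \<mu>))"
        by (rule measurable_compose[OF measurable_component_singleton[OF j]])
    qed
    then show "kernel_section (u \<rightarrow>\<^sub>E space \<mu>) (product_kernel K u) y \<in> borel_measurable (Pi\<^sub>M u (\<lambda>_. \<mu>))"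
      by (rule measurable_cong[THEN iffD2, rotated])
         (simp add: kernel_section_def product_kernel_def space_PiM)
  qed
qed

text \<open>The pointwise bound by the norm times the root of the kernel diagonal has a product form
  in the coordinates, and each coordinate integrates to \<open>M\<close>.\<close>

lemma component_integrable_and_bound:
  assumes u: "finite u" and f: "f \<in> H u"
  shows "integrable (Pi\<^sub>M u (\<lambda>_. \<mu>)) f"
    and "(LINT x|Pi\<^sub>M u (\<lambda>_. \<mu>). \<bar>f x\<bar>) \<le> ip_norm (ip u) f * M ^ card u"
proof -
  interpret R: rkhs "u \<rightarrow>\<^sub>E space \<mu>" "product_kernel K u" "H u" "ip u" using u by (rule spaces)
  let ?N = "Pi\<^sub>M u (\<lambda>_. \<mu>)"
  let ?g = "\<lambda>x. \<Prod>j\<in>u. sqrt (K (x j) (x j))"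
  have g: "integrable ?N ?g"
    by (rule product_integrable_prod) (use u kernel_integrable in auto)
  have g_int: "(LINT x|?N. ?g x) = M ^ card u"
    by (subst product_integral_prod) (use u kernel_integrable in \<open>auto simp: M_eq\<close>)
  have le: "\<bar>f x\<bar> \<le> ip_norm (ip u) f * ?g x" if x: "x \<in> space ?N" for x
  proof -
    have "sqrt (product_kernel K u x x) = ?g x"
      unfolding product_kernel_def by (induction u rule: infinite_finite_induct) (auto simp: real_sqrt_mult)
    then show ?thesis using R.abs_eval_le[OF f, of x] x by (simp add: space_PiM)
  qed
  have gi: "integrable ?N (\<lambda>x. ip_norm (ip u) f * ?g x)" using g by simp
  show int: "integrable ?N f"
  proof (rule Bochner_Integration.integrable_bound[OF gi measurable_component[OF u f]], rule AE_I2)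
    fix x assume "x \<in> space ?N"
    then show "norm (f x) \<le> norm (ip_norm (ip u) f * ?g x)" using le[of x] by (metis abs_ge_self order_trans real_norm_def)
  qed
  have "(LINT x|?N. \<bar>f x\<bar>) \<le> (LINT x|?N. ip_norm (ip u) f * ?g x)"
    using int gi le by (intro integral_mono) auto
  then show "(LINT x|?N. \<bar>f x\<bar>) \<le> ip_norm (ip u) f * M ^ card u" by (simp add: g_int)
qed

lemma abs_component_integral_le:
  assumes "finite u" "f \<in> H u"
  shows "\<bar>LINT x|Pi\<^sub>M u (\<lambda>_. \<mu>). f x\<bar> \<le> ip_norm (ip u) f * M ^ card u"
  using integral_abs_bound[of "Pi\<^sub>M u (\<lambda>_. \<mu>)" f] component_integrable_and_bound(2)[OF assms] by linarith

lemma integral_has_sum_components: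
  assumes Fu: "\<And>u. finite u \<Longrightarrow> Fu u \<in> H u"
    and F: "F \<in> borel_measurable (Pi\<^sub>M UNIV (\<lambda>_. \<mu>))"
    and ae: "AE y in Pi\<^sub>M UNIV (\<lambda>_. \<mu>). ((\<lambda>u. Fu u (restrict y u)) has_sum F y) {u. finite u}"
    and sm: "(\<lambda>u. ip_norm (ip u) (Fu u) * M ^ card u) summable_on {u. finite u}"
  shows "((\<lambda>u. LINT x|Pi\<^sub>M u (\<lambda>_. \<mu>). Fu u x) has_sum (LINT y|Pi\<^sub>M UNIV (\<lambda>_. \<mu>). F y)) {u. finite u}"
proof -
  let ?P = "Pi\<^sub>M (UNIV :: nat set) (\<lambda>_. \<mu>)"
  let ?G = "\<lambda>i y. Fu (set_decode i) (restrict y (set_decode i))"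
  \<comment> \<open>Binary expansion enumerates the finite sets of indices, so that the unordered
    sum becomes a series to which termwise integration applies.\<close>
  have bij: "bij_betw set_decode UNIV {u. finite u}"
    by (rule bij_betwI[where g = set_encode]) auto
  have restrict: "(\<lambda>y. restrict y u) \<in> measurable ?P (Pi\<^sub>M u (\<lambda>_. \<mu>))" for u :: "nat set"
    by (rule measurable_restrict_subset) simp
  have distr: "distr ?P (Pi\<^sub>M u (\<lambda>_. \<mu>)) (\<lambda>y. restrict y u) = Pi\<^sub>M u (\<lambda>_. \<mu>)" if "finite u" for u
    using distr_PiM_restrict_finite[OF that] by simp
  have int_restrict: "(LINT y|?P. h (restrict y u)) = (LINT x|Pi\<^sub>M u (\<lambda>_. \<mu>). h x)"
    if "finite u" "h \<in> borel_measurable (Pi\<^sub>M u (\<lambda>_. \<mu>))" for u and h :: "_ \<Rightarrow> real"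
    using integral_distr[OF restrict that(2)] distr[OF that(1)] by simp
  have G_int: "integrable ?P (?G i)" for i
    using component_integrable_and_bound(1)[OF _ Fu, of "set_decode i"]
    by (intro integrable_distr[OF restrict]) (simp add: distr)
  have ae': "AE y in ?P. ((\<lambda>i. ?G i y) has_sum F y) UNIV"
    using ae by eventually_elim (subst has_sum_reindex_bij_betw[OF bij, of "\<lambda>u. Fu u (restrict _ u)"])
  \<comment> \<open>Unordered convergence of a real family is already absolute convergence.\<close>
  have G_sum: "AE y in ?P. summable (\<lambda>i. norm (?G i y))"
    using ae'
  proof eventually_elim
    case (elim y)
    then have "(\<lambda>i. ?G i y) summable_on UNIV" by (auto simp: summable_on_def)
    then have "(\<lambda>i. norm (?G i y)) summable_on UNIV"
      by (rule summable_on_iff_abs_summable_on_real[THEN iffD1])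
    then show ?case by (rule summable_on_imp_summable)
  qed
  have norm_G: "(LINT y|?P. norm (?G i y)) = (LINT x|Pi\<^sub>M (set_decode i) (\<lambda>_. \<mu>). \<bar>Fu (set_decode i) x\<bar>)" for i
    using int_restrict[of "set_decode i" "\<lambda>x. \<bar>Fu (set_decode i) x\<bar>"]
      measurable_component[OF _ Fu, of "set_decode i"] by simp
  have "(\<lambda>i. ip_norm (ip (set_decode i)) (Fu (set_decode i)) * M ^ card (set_decode i)) summable_on UNIV"
    using sm by (subst summable_on_reindex_bij_betw[OF bij])
  then have "summable (\<lambda>i. ip_norm (ip (set_decode i)) (Fu (set_decode i)) * M ^ card (set_decode i))"
    by (rule summable_on_imp_summable)
  then have G_norm: "summable (\<lambda>i. LINT y|?P. norm (?G i y))"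
    unfolding norm_G
    by (rule summable_comparison_test')
       (auto intro!: component_integrable_and_bound(2) Fu integral_nonneg_AE simp: abs_of_nonneg)
  have "(LINT y|?P. F y) = (LINT y|?P. (\<Sum>i. ?G i y))"
  proof (rule integral_cong_AE)
    show "(\<lambda>y. \<Sum>i. ?G i y) \<in> borel_measurable ?P"
      by (intro borel_measurable_suminf borel_measurable_integrable G_int)
    show "AE y in ?P. F y = (\<Sum>i. ?G i y)"
      using ae' by eventually_elim (auto dest!: has_sum_imp_sums simp: sums_iff)
  qed (rule F)
  then have sums: "(\<lambda>i. LINT y|?P. ?G i y) sums (LINT y|?P. F y)"
    using sums_integral[OF G_int G_sum G_norm] by simp
  \<comment> \<open>Absolute convergence of the integrals is what permits the return from the series
    to the unordered sum.\<close>
  have "summable (\<lambda>i. norm (LINT y|?P. ?G i y))"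
    using G_norm by (rule summable_comparison_test') (simp only: real_norm_def abs_abs integral_abs_bound)
  then have "((\<lambda>i. LINT y|?P. ?G i y) has_sum (LINT y|?P. F y)) UNIV"
    using sums by (rule norm_summable_imp_has_sum)
  then have "((\<lambda>i. LINT x|Pi\<^sub>M (set_decode i) (\<lambda>_. \<mu>). Fu (set_decode i) x) has_sum (LINT y|?P. F y)) UNIV"
    using int_restrict[OF _ measurable_component[OF _ Fu]] by simp
  then show ?thesis
    by (subst (asm) has_sum_reindex_bij_betw[OF bij, of "\<lambda>u. LINT x|Pi\<^sub>M u (\<lambda>_. \<mu>). Fu u x"])
qed

end

subsection \<open>Active set, numbers of nodes and cost\<close>

lemma round_pow2_le: "x > 0 \<Longrightarrow> real (round_pow2 x) \<le> x"
proof (cases "x \<ge> 1")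
  case True
  then have "real_of_int \<lfloor>log 2 x\<rfloor> \<ge> 0" by simp
  then have "(2::real) ^ nat \<lfloor>log 2 x\<rfloor> = 2 powr real_of_int \<lfloor>log 2 x\<rfloor>"
    by (simp flip: powr_realpow)
  also have "\<dots> \<le> 2 powr log 2 x" by (intro powr_mono) auto
  finally show ?thesis using True by (simp add: round_pow2_def)
qed (simp add: round_pow2_def)

text \<open>Rounding down to a power of two loses at most a factor 2; this is the origin of
  \<open>2 powr lam\<close> in \<open>error_weight\<close>.\<close>

lemma round_pow2_ge:
  assumes "x \<ge> 1"
  shows "real (round_pow2 x) \<ge> x / 2"
proof -
  have "real_of_int \<lfloor>log 2 x\<rfloor> \<ge> 0" using assms by simp
  then have "(2::real) ^ nat \<lfloor>log 2 x\<rfloor> = 2 powr real_of_int \<lfloor>log 2 x\<rfloor>"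
    by (simp flip: powr_realpow)
  also have "\<dots> \<ge> 2 powr (log 2 x - 1)" by (intro powr_mono) linarith+
  also have "2 powr (log 2 x - 1) = x / 2" using assms by (simp add: powr_diff)
  finally show ?thesis using assms by (simp add: round_pow2_def)
qed

section \<open>Estimates for the log factor\<close>

lemma log_factor_upper:
  assumes "finite U"
  shows "1 \<le> log_factor lam1 U m"
    and "\<And>u. u \<in> U \<Longrightarrow> u \<noteq> {} \<Longrightarrow> m u \<ge> 1 \<Longrightarrow>
      rpow (ln (real (m u)) / real (card u)) (lam1 * real (card u)) \<le> log_factor lam1 U m"
  unfolding log_factor_def using assms by (auto intro!: Max_ge)

lemma log_factor_le:
  assumes "finite U" "1 \<le> B"
    and "\<And>u. u \<in> U \<Longrightarrow> u \<noteq> {} \<Longrightarrow> m u \<ge> 1 \<Longrightarrow>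
      rpow (ln (real (m u)) / real (card u)) (lam1 * real (card u)) \<le> B"
  shows "log_factor lam1 U m \<le> B"
  unfolding log_factor_def using assms by (subst Max_le_iff) auto

text \<open>From ln(y/l) <= y/l - 1. The free scale \<open>y\<close> replaces the unknown
  \<open>l\<close> inside the logarithm at the price of adding \<open>y\<close>.\<close>

lemma mult_ln_divide_le:
  fixes l x y :: real
  assumes "l > 0" "x > 0" "y > 0"
  shows "l * ln (x / l) \<le> l * ln (x / y) + y"
proof -
  have "ln (x / l) = ln (x / y) + ln (y / l)" using assms by (simp add: ln_div)
  moreover have "l * ln (y / l) \<le> y"
  proof -
    have "l * ln (y / l) \<le> l * (y / l - 1)" using assms by (intro mult_left_mono ln_le_minus_one) auto
    also have "\<dots> \<le> y" using assms by (simp add: right_diff_distrib)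
    finally show ?thesis .
  qed
  ultimately show ?thesis by (simp add: distrib_left)
qed

text \<open>
  Here \<open>l\<close> is a cardinality, \<open>x\<close> the logarithm of a number of nodes and
  \<open>w = ln (1 / \<epsilon>)\<close>; the bound on \<open>l * ln l\<close> forces \<open>l = O(w / ln w)\<close>.
\<close>
lemma eventually_mult_ln_divide_le:
  fixes b c d c2 d2 :: real
  assumes "c \<ge> 0" "c2 \<ge> 0"
  shows "eventually (\<lambda>w. \<forall>l x. l > 0 \<longrightarrow> x > 0 \<longrightarrow> l * ln l \<le> b * l + c * w + d \<longrightarrow> x \<le> c2 * w + d2 \<longrightarrow>
      l * ln (x / l) \<le> (4 * (c + 2) + 1) * (w / ln w * ln (ln w))) at_top"
proof -
  have "eventually (\<lambda>w::real. w > 0) at_top" by (rule eventually_gt_at_top)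
  moreover have "eventually (\<lambda>w::real. ln w > 0) at_top" by real_asymp
  moreover have "eventually (\<lambda>w::real. ln (ln w) \<ge> 1) at_top" by real_asymp
  moreover have "eventually (\<lambda>w::real. ln w - ln (ln w) - b \<ge> ln w / 2) at_top" by real_asymp
  moreover have "eventually (\<lambda>w::real. w / ln w + d \<le> 2 * w) at_top" by real_asymp
  moreover have "eventually (\<lambda>w::real. d2 \<le> w) at_top" by (rule eventually_ge_at_top)
  moreover have "eventually (\<lambda>w::real. c2 + 1 \<le> ln w) at_top" by real_asymp
  ultimately show ?thesis
  proof (eventually_elim, intro allI impI)
    fix w l x :: real
    assume w: "w > 0" "ln w > 0" "ln (ln w) \<ge> 1" "ln w - ln (ln w) - b \<ge> ln w / 2"
      "w / ln w + d \<le> 2 * w" "d2 \<le> w" "c2 + 1 \<le> ln w"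
    assume l: "l > 0" and x: "x > 0" and l1: "l * ln l \<le> b * l + c * w + d" and x1: "x \<le> c2 * w + d2"
    \<comment> \<open>\<open>y\<close> is the order of magnitude to be established for
      \<open>l\<close>. Its logarithm exceeds \<open>b\<close> by at least half of
      \<open>ln w\<close>, so after the terms \<open>b * l\<close> cancel,
      \<open>l * ln w / 2\<close> is O(w).\<close>
    define y where "y = w / ln w"
    have y: "y > 0" using w by (simp add: y_def)
    have lny: "ln y = ln w - ln (ln w)" using w by (simp add: y_def ln_div)
    have "l * (ln w / 2) \<le> l * (ln y - b)" using w(4) l by (simp add: lny)
    also have "\<dots> = l * ln l + l * ln (y / l) - b * l"
      using y l by (simp add: ln_div algebra_simps)
    also have "l * ln (y / l) \<le> y" using mult_ln_divide_le[OF l y y] y by simp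
    also have "l * ln l + y - b * l \<le> (c + 2) * w"
      using l1 w(5) by (simp add: y_def algebra_simps)
    finally have "l * (ln w / 2) \<le> (c + 2) * w" by simp
    then have ly: "l \<le> 2 * (c + 2) * y" using w(2) by (simp add: y_def field_simps)
    have "x / y \<le> (c2 * w + w) / y" using x1 w(6) y by (intro divide_right_mono) auto
    also have "\<dots> = (c2 + 1) * ln w" using w by (simp add: y_def field_simps)
    also have "\<dots> \<le> ln w * ln w" using w(2,7) by (intro mult_right_mono) auto
    finally have "ln (x / y) \<le> ln (ln w * ln w)" using x y w(2) by (subst ln_le_cancel_iff) auto
    then have lnxy: "ln (x / y) \<le> 2 * ln (ln w)" using w(2) by (simp add: ln_mult)
    have "l * ln (x / y) \<le> l * (2 * ln (ln w))" using lnxy l by (intro mult_left_mono) auto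
    also have "\<dots> \<le> (2 * (c + 2) * y) * (2 * ln (ln w))" using ly w(3) by (intro mult_right_mono) auto
    also have "\<dots> = 4 * (c + 2) * (y * ln (ln w))" by simp
    finally have "l * ln (x / y) \<le> 4 * (c + 2) * (y * ln (ln w))" .
    \<comment> \<open>The constant is 2(c+2) from the bound on \<open>l\<close>, times 2 from the
      bound on \<open>ln (x / y)\<close>, plus 1 for this correction term.\<close>
    moreover have "y \<le> y * ln (ln w)" using y w(3) by simp
    ultimately have "l * ln (x / l) \<le> 4 * (c + 2) * (y * ln (ln w)) + y * ln (ln w)"
      using mult_ln_divide_le[OF l x y] by linarith
    then show "l * ln (x / l) \<le> (4 * (c + 2) + 1) * (w / ln w * ln (ln w))"
      by (simp only: y_def distrib_right mult_1)
  qed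
qed

locale mdm_weights =
  fixes \<gamma> :: "nat \<Rightarrow> real" and M :: real and q \<rho> :: ereal and pstar lam lam1 :: real
    and C :: "nat set \<Rightarrow> real" and cst :: "nat \<Rightarrow> real"
  assumes gamma_pos: "\<And>j. \<gamma> j > 0" and M_nonneg: "M \<ge> 0"
    and q: "1 \<le> q" and pstar: "0 < pstar" "ereal pstar < q"
    and gamma_summable: "summable (\<lambda>j. \<gamma> j powr pstar)"
    and rho: "1 < \<rho>" "\<rho> \<le> q / ereal pstar"
    and lam: "0 < lam" "lam \<le> 1 / pstar - real_of_ereal (1 / q)"
    and lam1: "0 \<le> lam1" "lam1 < lam + real_of_ereal (1 / q)"
    and C_pos: "\<And>u. finite u \<Longrightarrow> C u > 0"
    and C_exp: "at_most_exponential C"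
    and cst_ge: "\<And>d. cst d \<ge> 1"
    and cst_exp: "at_most_exponential (\<lambda>u. cst (card u))"
begin

section \<open>Exponents and summability of the weights\<close>

definition wM :: "nat set \<Rightarrow> real" where "wM u = weight \<gamma> u * M ^ card u"

definition r where "r = real_of_ereal (1 / q)"

text \<open>The exponent q/(q lam + 1) in the choice of k_u, in a form that also covers q =
  infinity, where it is 1/lam.\<close>

definition s where "s = 1 / (lam + r)"

definition g where "g = error_weight \<gamma> C lam lam1"

lemma q_cases:
  obtains "q = \<infinity>" "r = 0"
    | q' where "q = ereal q'" "q' \<ge> 1" "pstar < q'" "r = 1 / q'"
proof (cases q)
  case (real q')
  then have "q' \<ge> 1" using q by (simp add: one_ereal_def)
  moreover have "real_of_ereal (1 / q) = 1 / q'"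
    using calculation real by (simp add: one_ereal_def divide_ereal_def inverse_eq_divide)
  then have "r = 1 / q'" by (simp only: r_def)
  ultimately show ?thesis using that(2) real pstar by auto
next
  case PInf
  then have "r = 0" unfolding r_def by simp
  then show ?thesis using that(1) PInf by simp
qed (use q in auto)

lemma rho_cases:
  obtains "\<rho> = \<infinity>" "q = \<infinity>" "real_of_ereal (1 / \<rho>) = 0"
    | \<rho>' where "\<rho> = ereal \<rho>'" "\<rho>' > 1" "real_of_ereal (1 / \<rho>) = 1 / \<rho>'"
      "\<And>q'. q = ereal q' \<Longrightarrow> pstar \<le> q' / \<rho>'"
proof (cases \<rho>)
  case (real \<rho>')
  have "\<rho>' > 1" using rho(1) real by (simp add: one_ereal_def)
  moreover have "pstar \<le> q' / \<rho>'" if "q = ereal q'" for q'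
    using rho(2) real that pstar(1) \<open>\<rho>' > 1\<close> by (simp add: divide_simps mult.commute)
  moreover have "real_of_ereal (1 / \<rho>) = 1 / \<rho>'"
    using real \<open>\<rho>' > 1\<close> by (simp add: one_ereal_def divide_ereal_def inverse_eq_divide)
  ultimately show ?thesis using that(2) real by blast
next
  case PInf
  then have "q = \<infinity>" using rho(2) pstar by (cases q) (auto simp: divide_ereal_def)
  then show ?thesis using that(1) PInf by simp
qed (use rho in auto)

lemma r_nonneg: "r \<ge> 0"
  by (cases rule: q_cases) auto

lemma s_pos: "s > 0" and s_ge: "s \<ge> pstar" and lam1_s: "lam1 * s < 1"
  and lam_s: "lam * s + r * s = 1"
proof -
  have p: "lam + r > 0" using lam(1) r_nonneg by simp
  then show "s > 0" by (simp add: s_def)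
  have "(lam + r) * pstar \<le> 1"
    using lam(2) pstar(1) by (simp add: r_def field_simps)
  then show "s \<ge> pstar" using p by (simp add: s_def field_simps)
  show "lam1 * s < 1" using lam1(2) p by (simp add: s_def r_def)
  show "lam * s + r * s = 1" using p by (simp add: s_def flip: add_divide_distrib)
qed

lemma weight_gt: "weight \<gamma> u > 0"
  using gamma_pos by (rule weight_pos)

lemma wM_nonneg: "wM u \<ge> 0"
  using weight_gt[of u] M_nonneg by (simp add: wM_def)

lemma wM_empty [simp]: "wM {} = 1"
  by (simp add: wM_def weight_def)

lemma wM_powr: "wM u powr t = (M powr t) ^ card u * weight \<gamma> u powr t"
proof -
  have "(M ^ m) powr t = (M powr t) ^ m" for m
    by (induction m) (simp_all add: powr_mult)
  then show ?thesis by (simp add: wM_def powr_mult)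
qed

lemma wM_summable:
  assumes "t \<ge> pstar"
  shows "(\<lambda>u. wM u powr t) summable_on {u. finite u}"
  using summable_on_weight[OF gamma_summable gamma_pos pstar(1) assms, of "M powr t" 0]
  by (simp add: wM_powr rpow_def)

lemma sum_wM_le:
  assumes "t \<ge> pstar" "finite T" "\<And>u. u \<in> T \<Longrightarrow> finite u"
  shows "(\<Sum>u\<in>T. wM u powr t) \<le> (\<Sum>\<^sub>\<infinity>u\<in>{u. finite u}. wM u powr t)"
  using assms by (intro finite_sum_le_infsum wM_summable) auto

lemma wM_bounded:
  obtains B where "B \<ge> 0" "\<And>u. finite u \<Longrightarrow> wM u \<le> B"
proof
  let ?S = "\<Sum>\<^sub>\<infinity>u\<in>{u. finite u}. wM u powr pstar"
  show "?S powr (1 / pstar) \<ge> 0" by simp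
  fix u :: "nat set" assume "finite u"
  then have "wM u powr pstar \<le> ?S" using sum_wM_le[of pstar "{u}"] by simp
  then have "(wM u powr pstar) powr (1 / pstar) \<le> ?S powr (1 / pstar)"
    using pstar(1) by (intro powr_mono2) auto
  then show "wM u \<le> ?S powr (1 / pstar)" using pstar(1) wM_nonneg[of u] by (simp add: powr_powr)
qed

text \<open>Because \<open>pstar < q\<close>, summability of the powers \<open>pstar\<close> also
  controls the l^q-norm. That \<open>B\<close> does not depend on \<open>T\<close> is what makes the
  sum of ||F_u|| M_u converge.\<close>

lemma wM_lq_bounded:
  obtains B where "B \<ge> 0" "\<And>T. finite T \<Longrightarrow> (\<And>u. u \<in> T \<Longrightarrow> finite u) \<Longrightarrow> lq_bounded q wM T B"
proof (cases rule: q_cases)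
  case 1
  obtain B where "B \<ge> 0" "\<And>u. finite u \<Longrightarrow> wM u \<le> B" using wM_bounded by blast
  then show ?thesis using that[of B] 1 by (simp add: lq_bounded_def)
next
  case (2 q')
  let ?S = "\<Sum>\<^sub>\<infinity>u\<in>{u. finite u}. wM u powr q'"
  have "?S \<ge> 0" by (intro infsum_nonneg) simp
  then have "lq_bounded q wM T (?S powr (1 / q'))" if "finite T" "\<And>u. u \<in> T \<Longrightarrow> finite u" for T
    using sum_wM_le[of q' T] that 2 by (simp add: lq_bounded_def powr_powr)
  then show ?thesis using that[of "?S powr (1 / q')"] by simp
qed

section \<open>The active set and the truncation error\<close>

definition D where "D = active_denominator \<gamma> M q \<rho>"

lemma one_minus_inverse_rho: "0 < 1 - real_of_ereal (1 / \<rho>)" "0 \<le> real_of_ereal (1 / \<rho>)"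
  by (cases rule: rho_cases; simp)+

lemma D_inf:
  assumes "q = \<infinity>" "finite u"
  shows "rpow (wM u) (real_of_ereal (1 / \<rho>)) \<le> D"
proof -
  obtain B where B: "B \<ge> 0" "\<And>u. finite u \<Longrightarrow> wM u \<le> B" using wM_bounded by blast
  \<comment> \<open>Boundedness makes the real supremum in \<open>D\<close> a genuine upper bound.
    The \<open>max 1\<close> covers 1/rho = 0, where \<open>rpow\<close> is constantly 1.\<close>
  have "bdd_above ((\<lambda>v. rpow (wM v) (real_of_ereal (1 / \<rho>))) ` {v. finite v})"
  proof (rule bdd_aboveI2)
    fix v :: "nat set" assume "v \<in> {v. finite v}"
    then show "rpow (wM v) (real_of_ereal (1 / \<rho>)) \<le> max 1 (B powr real_of_ereal (1 / \<rho>))"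
      using B(2)[of v] powr_mono2[OF one_minus_inverse_rho(2) wM_nonneg, of v B]
      by (simp add: rpow_def le_max_iff_disj)
  qed
  then show ?thesis
    unfolding D_def active_denominator_def wM_def[symmetric] using assms
    by (auto intro: cSUP_upper)
qed

lemma D_fin:
  assumes "q = ereal q'" "finite T" "\<And>u. u \<in> T \<Longrightarrow> finite u"
  shows "(\<Sum>u\<in>T. rpow (wM u) (q' * real_of_ereal (1 / \<rho>))) \<le> D powr q'"
proof (cases rule: rho_cases)
  case 1
  then show ?thesis using assms by simp
next
  case (2 \<rho>')
  have q': "q' \<ge> 1" using q assms by (simp add: one_ereal_def)
  have e: "q' / \<rho>' \<ge> pstar" using 2(4)[OF assms(1)] .
  let ?S = "\<Sum>\<^sub>\<infinity>u\<in>{u. finite u}. wM u powr (q' / \<rho>')"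
  have S: "?S \<ge> 0" by (intro infsum_nonneg) simp
  have nz: "q' / \<rho>' \<noteq> 0" using e pstar(1) by linarith
  have "real_of_ereal (q / \<rho>) = q' / \<rho>'" using 2 assms by (simp add: divide_ereal_def inverse_eq_divide)
  then have "D = ?S powr (1 / q')"
    unfolding D_def active_denominator_def wM_def using assms nz by (simp add: rpow_def)
  then have "D powr q' = ?S" using S q' by (simp add: powr_powr)
  then show ?thesis
    using sum_wM_le[OF e assms(2,3)] nz 2(3) by (simp add: rpow_def)
qed

text \<open>The empty set contributes 1 to the supremum or sum, whatever the exponent.\<close>

lemma D_ge: "D \<ge> 1"
proof (cases rule: q_cases)
  case 1
  show ?thesis using D_inf[OF 1(1), of "{}"] by (simp add: rpow_def split: if_splits)
next
  case (2 q')
  have "1 \<le> D powr q'" using D_fin[OF 2(1), of "{{}}"] by (simp add: rpow_def split: if_splits)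
  moreover have "D \<ge> 0" unfolding D_def active_denominator_def using 2 by simp
  ultimately show ?thesis using 2(2) powr_less_mono2[of q' D 1] by fastforce
qed

lemma active_set_iff:
  "u \<in> active_set \<gamma> M q \<rho> \<epsilon> \<longleftrightarrow>
     finite u \<and> wM u powr (1 - real_of_ereal (1 / \<rho>)) > (\<epsilon> / 2) / D"
  using one_minus_inverse_rho(1) by (simp add: active_set_def wM_def D_def rpow_def)

text \<open>The threshold is transported to the exponent \<open>pstar\<close>, at which the weights
  are summable; both the finiteness of the active set and the bound on cardinalities start
  here.\<close>

lemma active_wM_gt:
  assumes "u \<in> active_set \<gamma> M q \<rho> \<epsilon>" "\<epsilon> > 0"
  shows "wM u powr pstar > ((\<epsilon> / 2) / D) powr (pstar / (1 - real_of_ereal (1 / \<rho>)))"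
proof -
  let ?a = "1 - real_of_ereal (1 / \<rho>)"
  have "((\<epsilon> / 2) / D) powr (pstar / ?a) < (wM u powr ?a) powr (pstar / ?a)"
    using assms one_minus_inverse_rho(1) pstar(1) D_ge
    by (intro powr_less_mono2) (auto simp: active_set_iff)
  then show ?thesis using one_minus_inverse_rho(1) by (simp add: powr_powr)
qed

text \<open>Markov-type counting: every active set contributes more than \<open>?t\<close> to a
  convergent sum, so there are at most \<open>?S / ?t\<close> of them.\<close>

lemma finite_active_set:
  assumes "\<epsilon> > 0"
  shows "finite (active_set \<gamma> M q \<rho> \<epsilon>)"
proof (rule finite_if_finite_subsets_card_bdd[THEN conjunct1])
  let ?t = "((\<epsilon> / 2) / D) powr (pstar / (1 - real_of_ereal (1 / \<rho>)))"
  let ?S = "\<Sum>\<^sub>\<infinity>u\<in>{u. finite u}. wM u powr pstar"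
  have t: "?t > 0" using assms D_ge by simp
  fix T assume T: "T \<subseteq> active_set \<gamma> M q \<rho> \<epsilon>" "finite T"
  have "real (card T) * ?t = (\<Sum>u\<in>T. ?t)" by simp
  also have "\<dots> \<le> (\<Sum>u\<in>T. wM u powr pstar)"
    using T assms by (intro sum_mono less_imp_le active_wM_gt) auto
  also have "\<dots> \<le> ?S" using T by (intro sum_wM_le) (auto simp: active_set_iff)
  finally have "real (card T) \<le> ?S / ?t" using t by (simp add: le_divide_eq)
  then show "card T \<le> nat \<lceil>?S / ?t\<rceil>" by linarith
qed

lemma truncation_lq_bounded:
  assumes "\<epsilon> > 0" "finite T" "\<And>u. u \<in> T \<Longrightarrow> finite u" "T \<inter> active_set \<gamma> M q \<rho> \<epsilon> = {}"
  shows "lq_bounded q wM T (\<epsilon> / 2)"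
proof -
  let ?b = "real_of_ereal (1 / \<rho>)"
  let ?a = "1 - ?b"
  have a: "rpow (wM u) ?a \<le> (\<epsilon> / 2) / D" if "u \<in> T" for u
    using that assms(3)[OF that] assms(4) one_minus_inverse_rho(1)
    by (force simp: active_set_iff rpow_def)
  have split: "wM u = rpow (wM u) ?a * rpow (wM u) ?b" for u
    using rpow_mult_complement[OF wM_nonneg one_minus_inverse_rho] by simp
  show ?thesis
  proof (cases rule: q_cases)
    case 1
    have "wM u \<le> \<epsilon> / 2" if "u \<in> T" for u
    proof -
      have "wM u = rpow (wM u) ?a * rpow (wM u) ?b" by (rule split)
      also have "\<dots> \<le> (\<epsilon> / 2) / D * D"
        using a[OF that] D_inf[OF 1(1) assms(3)[OF that]] D_ge assms(1)
        by (intro mult_mono) (auto simp: rpow_nonneg)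
      finally show ?thesis using D_ge by simp
    qed
    then show ?thesis using 1 by (simp add: lq_bounded_def)
  next
    case (2 q')
    have "(\<Sum>u\<in>T. wM u powr q') \<le> (\<Sum>u\<in>T. ((\<epsilon> / 2) / D) powr q' * rpow (wM u) (q' * ?b))"
    proof (rule sum_mono)
      fix u assume u: "u \<in> T"
      have "wM u powr q' = rpow (wM u) ?a powr q' * rpow (wM u) ?b powr q'"
        by (subst split) (rule powr_mult)
      also have "\<dots> = rpow (wM u) ?a powr q' * rpow (wM u) (q' * ?b)"
        using 2 wM_nonneg[of u] by (simp add: rpow_powr mult.commute)
      also have "\<dots> \<le> ((\<epsilon> / 2) / D) powr q' * rpow (wM u) (q' * ?b)"
        using a[OF u] 2 by (intro mult_right_mono powr_mono2) (auto simp: rpow_nonneg)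
      finally show "wM u powr q' \<le> ((\<epsilon> / 2) / D) powr q' * rpow (wM u) (q' * ?b)" .
    qed
    also have "\<dots> \<le> ((\<epsilon> / 2) / D) powr q' * D powr q'"
      unfolding sum_distrib_left[symmetric]
      using D_fin[OF 2(1) assms(2,3)] by (intro mult_left_mono) auto
    also have "\<dots> = (\<epsilon> / 2) powr q'"
      using D_ge assms(1) by (simp flip: powr_mult)
    finally show ?thesis using 2 by (simp add: lq_bounded_def)
  qed
qed

section \<open>The choice of \<open>k\<close> and the cubature error\<close>

lemma g_eq: "g u = weight \<gamma> u * 2 powr lam * C u * rpow (real (card u)) (lam1 * real (card u))"
  by (simp add: g_def error_weight_def)

lemma g_pos: "finite u \<Longrightarrow> g u > 0"
  using weight_gt[of u] C_pos[of u] by (auto simp: g_eq rpow_def card_gt_0_iff)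

text \<open>The sum \<open>L \<epsilon>\<close> extended to all finite sets, hence a bound free of
  \<epsilon>.\<close>

definition E where "E = (\<Sum>\<^sub>\<infinity>u\<in>{u. finite u}. cst (card u) powr (lam * s) * g u powr s)"

lemma cost_terms_summable:
  "(\<lambda>u. cst (card u) powr (lam * s) * g u powr s) summable_on {u. finite u}"
proof -
  obtain c T where c: "c > 0" "T > 0" "\<And>u. finite u \<Longrightarrow> C u \<le> c * T ^ card u"
    using C_exp by (auto simp: at_most_exponential_def)
  obtain c' T' where c': "c' > 0" "T' > 0" "\<And>u::nat set. finite u \<Longrightarrow> cst (card u) \<le> c' * T' ^ card u"
    using cst_exp by (auto simp: at_most_exponential_def)
  have pw: "(x ^ m) powr t = (x powr t) ^ m" if "x > 0" for x t :: real and m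
    using that by (induction m) (simp_all add: powr_mult)
  \<comment> \<open>\<open>Z\<close> collects the geometric growth of the costs and error constants,
    \<open>A\<close> the factors that do not depend on \<open>u\<close>.\<close>
  define Z where "Z = T' powr (lam * s) * T powr s"
  define A where "A = c' powr (lam * s) * (2 powr lam) powr s * c powr s"
  have "(\<lambda>u. A * (Z ^ card u * rpow (real (card u)) (lam1 * s * real (card u)) * weight \<gamma> u powr s))
      summable_on {u. finite u}"
    using gamma_summable gamma_pos pstar(1) s_ge s_pos lam1(1) lam1_s
    by (intro summable_on_cmult_right summable_on_weight[of _ pstar]) (auto simp: Z_def)
  then show ?thesis
  proof (rule summable_on_comparison_test)
    fix u :: "nat set" assume "u \<in> {u. finite u}"
    then have u: "finite u" by simp
    have 1: "cst (card u) powr (lam * s) \<le> (c' * T' ^ card u) powr (lam * s)"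
      using c'(3)[OF u] cst_ge[of "card u"] lam(1) s_pos by (intro powr_mono2) auto
    have 2: "C u powr s \<le> (c * T ^ card u) powr s"
      using c(3)[OF u] C_pos[OF u] s_pos by (intro powr_mono2) auto
    have "rpow (real (card u)) (lam1 * real (card u)) powr s = rpow (real (card u)) (lam1 * s * real (card u))"
      using s_pos by (subst rpow_powr) (auto simp: mult_ac)
    then have g: "g u powr s = weight \<gamma> u powr s * (2 powr lam) powr s * C u powr s
        * rpow (real (card u)) (lam1 * s * real (card u))"
      by (simp only: g_eq powr_mult)
    have "cst (card u) powr (lam * s) * g u powr s
       \<le> (c' * T' ^ card u) powr (lam * s) * (weight \<gamma> u powr s * (2 powr lam) powr s * (c * T ^ card u) powr s
        * rpow (real (card u)) (lam1 * s * real (card u)))"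
      unfolding g using 1 2 by (intro mult_mono mult_left_mono mult_right_mono) (auto simp: rpow_nonneg)
    also have "\<dots> = A * (Z ^ card u * rpow (real (card u)) (lam1 * s * real (card u)) * weight \<gamma> u powr s)"
      using c(2) c'(2) by (simp add: A_def Z_def powr_mult pw power_mult_distrib)
    finally show "cst (card u) powr (lam * s) * g u powr s
       \<le> A * (Z ^ card u * rpow (real (card u)) (lam1 * s * real (card u)) * weight \<gamma> u powr s)" .
  qed simp
qed

lemma sum_cost_terms_le:
  assumes "finite T" "\<And>u. u \<in> T \<Longrightarrow> finite u"
  shows "(\<Sum>u\<in>T. cst (card u) powr (lam * s) * g u powr s) \<le> E"
  unfolding E_def using assms by (intro finite_sum_le_infsum cost_terms_summable) auto

definition L where
  "L \<epsilon> = (\<Sum>u\<in>active_set \<gamma> M q \<rho> \<epsilon>. cst (card u) powr (lam * s) * g u powr s)"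

definition k where
  "k \<epsilon> u = k_choice g cst q lam (active_set \<gamma> M q \<rho> \<epsilon>) \<epsilon> u"

lemma L_le: "\<epsilon> > 0 \<Longrightarrow> L \<epsilon> \<le> E"
  unfolding L_def by (intro sum_cost_terms_le finite_active_set) (auto simp: active_set_iff)

lemma L_nonneg: "L \<epsilon> \<ge> 0"
  unfolding L_def by (intro sum_nonneg) auto

lemma L_pos:
  assumes "\<epsilon> > 0" "u \<in> active_set \<gamma> M q \<rho> \<epsilon>"
  shows "L \<epsilon> > 0"
  unfolding L_def
proof (rule sum_pos2[OF finite_active_set[OF assms(1)] assms(2)])
  show "cst (card u) powr (lam * s) * g u powr s > 0"
    using g_pos[of u] cst_ge[of "card u"] assms(2) by (auto simp: active_set_iff)
qed auto

text \<open>With \<open>r = 1/q\<close>, the two cases in the choice of \<open>k\<close> become one formula.\<close>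
lemma k_eq:
  assumes "\<epsilon> > 0" "u \<in> active_set \<gamma> M q \<rho> \<epsilon>"
  shows "k \<epsilon> u = (\<epsilon> / 2) powr (- 1 / lam) * (g u / cst (card u) powr r) powr s * L \<epsilon> powr (r / lam)"
proof (cases rule: q_cases)
  case 1
  have "k \<epsilon> u = k_inf g lam \<epsilon> u"
    unfolding k_def k_choice_def using 1(1) by simp
  \<comment> \<open>For r = 0 the unified formula contains powers with exponent 0 of the cost and of
    \<open>L \<epsilon>\<close>. Since \<open>0 powr 0 = 0\<close>, they equal 1 only because both
    bases are nonzero.\<close>
  moreover have "cst (card u) \<noteq> 0" using cst_ge[of "card u"] by linarith
  moreover have "s = 1 / lam" using 1(2) by (simp add: s_def)
  ultimately show ?thesis
    using L_pos[OF assms] by (simp add: k_inf_def 1(2))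
next
  case (2 q')
  have "s = q' / (q' * lam + 1)" 
    unfolding s_def 2(4) using 2(2) by (simp add: field_simps)
  then have s: "q' / (q' * lam + 1) = s" "q' * lam / (q' * lam + 1) = lam * s" by (simp_all add: mult.commute)
  have "L_sum g cst q' lam (active_set \<gamma> M q \<rho> \<epsilon>) = L \<epsilon>"
    by (simp only: L_sum_def s L_def)
  moreover have "k \<epsilon> u = k_finite g cst q' lam (active_set \<gamma> M q \<rho> \<epsilon>) \<epsilon> u"
    unfolding k_def k_choice_def using 2(1) by simp
  ultimately show ?thesis
    by (simp add: k_finite_def s 2(4))
qed

lemma k_pos:
  assumes "\<epsilon> > 0" "u \<in> active_set \<gamma> M q \<rho> \<epsilon>"
  shows "k \<epsilon> u > 0"
  using k_eq[OF assms] assms L_pos[OF assms] g_pos[of u] cst_ge[of "card u"]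
  by (simp add: active_set_iff)

text \<open>Each active set receives epsilon/2 times the power 1/q of its share in
  \<open>L \<epsilon>\<close>; the shares of a nonempty active set add up to 1.\<close>

lemma g_times_k_powr:
  assumes "\<epsilon> > 0" "u \<in> active_set \<gamma> M q \<rho> \<epsilon>"
  shows "g u * k \<epsilon> u powr (- lam) = (\<epsilon> / 2) * (cst (card u) powr (lam * s) * g u powr s / L \<epsilon>) powr r"
proof -
  have g: "g u > 0" using assms(2) g_pos[of u] by (simp add: active_set_iff)
  have c: "cst (card u) > 0" using cst_ge[of "card u"] by linarith
  have Lp: "L \<epsilon> > 0" using L_pos[OF assms] .
  \<comment> \<open>In logarithms the identity is linear, and only
    \<open>lam * s + r * s = 1\<close> remains to be used.\<close>
  have "ln (k \<epsilon> u) = - 1 / lam * ln (\<epsilon> / 2) + s * (ln (g u) - r * ln (cst (card u))) + r / lam * ln (L \<epsilon>)"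
    unfolding k_eq[OF assms] using assms(1) g c Lp by (simp add: ln_mult ln_div ln_powr)
  then have "lam * ln (k \<epsilon> u) = lam * (- 1 / lam * ln (\<epsilon> / 2) + s * (ln (g u) - r * ln (cst (card u))) + r / lam * ln (L \<epsilon>))"
    by (simp only:)
  also have "\<dots> = - ln (\<epsilon> / 2) + lam * s * (ln (g u) - r * ln (cst (card u))) + r * ln (L \<epsilon>)"
    using lam(1) by (simp add: distrib_left right_diff_distrib)
  finally have lam_k: "lam * ln (k \<epsilon> u)
      = - ln (\<epsilon> / 2) + lam * s * (ln (g u) - r * ln (cst (card u))) + r * ln (L \<epsilon>)" .
  have "ln (g u * k \<epsilon> u powr (- lam)) = ln (g u) - lam * ln (k \<epsilon> u)"
    using g k_pos[OF assms] by (simp add: ln_mult ln_powr)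
  also have "\<dots> = ln (\<epsilon> / 2) + (1 - lam * s) * ln (g u) + r * (lam * s * ln (cst (card u)) - ln (L \<epsilon>))"
    unfolding lam_k by (simp add: algebra_simps)
  also have "1 - lam * s = r * s" using lam_s by simp
  also have "ln (\<epsilon> / 2) + r * s * ln (g u) + r * (lam * s * ln (cst (card u)) - ln (L \<epsilon>))
     = ln ((\<epsilon> / 2) * (cst (card u) powr (lam * s) * g u powr s / L \<epsilon>) powr r)"
    using assms(1) g c Lp by (simp add: ln_mult ln_div ln_powr algebra_simps)
  finally show ?thesis
    using assms(1) g c Lp k_pos[OF assms] by (subst (asm) ln_inj_iff) (auto intro!: mult_pos_pos)
qed

lemma cubature_lq_bounded:
  assumes "\<epsilon> > 0"
  shows "lq_bounded q (\<lambda>u. g u * k \<epsilon> u powr (- lam)) (active_set \<gamma> M q \<rho> \<epsilon>) (\<epsilon> / 2)"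
proof (cases rule: q_cases)
  case 1
  have "g u * k \<epsilon> u powr (- lam) \<le> \<epsilon> / 2" if "u \<in> active_set \<gamma> M q \<rho> \<epsilon>" for u
    unfolding g_times_k_powr[OF assms that] using 1 assms by simp
  then show ?thesis using 1(1) by (simp add: lq_bounded_def)
next
  case (2 q')
  let ?A = "active_set \<gamma> M q \<rho> \<epsilon>"
  have "(\<Sum>u\<in>?A. (g u * k \<epsilon> u powr (- lam)) powr q')
      = (\<Sum>u\<in>?A. (\<epsilon> / 2) powr q' * ((cst (card u) powr (lam * s) * g u powr s) / L \<epsilon>))"
  proof (rule sum.cong[OF refl])
    fix u assume u: "u \<in> ?A"
    have "0 \<le> cst (card u) powr (lam * s) * g u powr s / L \<epsilon>" using L_nonneg by simp
    then show "(g u * k \<epsilon> u powr (- lam)) powr q'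
        = (\<epsilon> / 2) powr q' * ((cst (card u) powr (lam * s) * g u powr s) / L \<epsilon>)"
      unfolding g_times_k_powr[OF assms u] powr_mult[of "\<epsilon> / 2"] using 2(2) L_nonneg[of \<epsilon>]
      by (simp add: powr_powr 2(4))
  qed
  also have "\<dots> = (\<epsilon> / 2) powr q' * (L \<epsilon> / L \<epsilon>)"
    by (simp only: L_def sum_distrib_left sum_divide_distrib)
  \<comment> \<open>Only an inequality, because the active set may be empty for large \<epsilon>;
    then \<open>L \<epsilon> / L \<epsilon>\<close> is 0.\<close>
  also have "\<dots> \<le> (\<epsilon> / 2) powr q'" by (cases "L \<epsilon> = 0") auto
  finally show ?thesis using 2(1) by (simp add: lq_bounded_def)
qed

section \<open>Numbers of nodes, cost and rounding\<close>

definition n where "n \<epsilon> u = round_pow2 (k \<epsilon> u)"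

text \<open>By \<open>lam_s\<close>, the cost of each component before rounding is a common factor
  times a summand of \<open>L \<epsilon>\<close>. The factor contains
  \<open>L \<epsilon> powr (r / lam)\<close>, which explains the exponent of
  \<open>E\<close>.\<close>

lemma cost_le:
  assumes "\<epsilon> > 0"
  shows "mdm_cost cst (active_set \<gamma> M q \<rho> \<epsilon>) (n \<epsilon>)
     \<le> (2 powr (1 / lam) * E powr (1 + r / lam)) * \<epsilon> powr (- 1 / lam)"
proof -
  let ?A = "active_set \<gamma> M q \<rho> \<epsilon>"
  have "mdm_cost cst ?A (n \<epsilon>) \<le> (\<Sum>u\<in>?A. k \<epsilon> u * cst (card u))"
    unfolding mdm_cost_def n_def
  proof (intro sum_mono mult_right_mono)
    fix u assume "u \<in> ?A"
    then show "real (round_pow2 (k \<epsilon> u)) \<le> k \<epsilon> u" by (intro round_pow2_le k_pos assms)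
    show "0 \<le> cst (card u)" using cst_ge[of "card u"] by linarith
  qed
  also have "\<dots> = (\<Sum>u\<in>?A. ((\<epsilon> / 2) powr (- 1 / lam) * L \<epsilon> powr (r / lam)) * (cst (card u) powr (lam * s) * g u powr s))"
  proof (rule sum.cong[OF refl])
    fix u assume u: "u \<in> ?A"
    have c: "cst (card u) > 0" using cst_ge[of "card u"] by linarith
    have "1 - r * s = lam * s" using lam_s by simp
    then have "cst (card u) powr (lam * s) = cst (card u) / cst (card u) powr (r * s)"
      using c powr_diff[of "cst (card u)" 1 "r * s"] by simp
    then show "k \<epsilon> u * cst (card u) = ((\<epsilon> / 2) powr (- 1 / lam) * L \<epsilon> powr (r / lam)) * (cst (card u) powr (lam * s) * g u powr s)"
      unfolding k_eq[OF assms u] by (simp add: powr_divide powr_powr)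
  qed
  also have "\<dots> = (\<epsilon> / 2) powr (- 1 / lam) * (L \<epsilon> powr (r / lam) * L \<epsilon>)"
    by (simp only: sum_distrib_left[symmetric] L_def[symmetric] mult.assoc)
  also have "L \<epsilon> powr (r / lam) * L \<epsilon> = L \<epsilon> powr (1 + r / lam)"
    using L_nonneg[of \<epsilon>] by (cases "L \<epsilon> = 0") (simp_all add: powr_add)
  also have "(\<epsilon> / 2) powr (- 1 / lam) * \<dots> \<le> (\<epsilon> / 2) powr (- 1 / lam) * E powr (1 + r / lam)"
    using L_nonneg L_le[OF assms] r_nonneg lam(1) by (intro mult_left_mono powr_mono2) auto
  also have "(\<epsilon> / 2) powr (- 1 / lam) = 2 powr (1 / lam) * \<epsilon> powr (- 1 / lam)"
    by (simp add: powr_divide powr_minus_divide)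
  finally show ?thesis by (simp add: mult_ac)
qed

text \<open>One component costs no more than all together. This crude bound suffices because only
  the logarithm of the number of nodes matters later.\<close>

lemma n_le:
  assumes "\<epsilon> > 0" "u \<in> active_set \<gamma> M q \<rho> \<epsilon>"
  shows "real (n \<epsilon> u) \<le> (2 powr (1 / lam) * E powr (1 + r / lam)) * \<epsilon> powr (- 1 / lam)"
proof -
  have "real (n \<epsilon> u) * 1 \<le> real (n \<epsilon> u) * cst (card u)"
    by (intro mult_left_mono cst_ge) auto
  also have "\<dots> \<le> mdm_cost cst (active_set \<gamma> M q \<rho> \<epsilon>) (n \<epsilon>)"
    unfolding mdm_cost_def
  proof (rule member_le_sum[OF assms(2)])
    show "0 \<le> real (n \<epsilon> v) * cst (card v)" for v using cst_ge[of "card v"] by simp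
  qed (rule finite_active_set[OF assms(1)])
  finally show ?thesis using cost_le[OF assms(1)] by simp
qed

lemma rate_le:
  assumes x: "x > 0" and m: "m = round_pow2 x" and "finite u"
    and lf: "lf \<ge> 1"
      "u \<noteq> {} \<Longrightarrow> m \<ge> 1 \<Longrightarrow> rpow (ln (real m) / real (card u)) (lam1 * real (card u)) \<le> lf"
  shows "weight \<gamma> u * (C u * rate lam lam1 (card u) m) \<le> lf * (g u * x powr (- lam))"
proof -
  let ?d = "rpow (real (card u)) (lam1 * real (card u))"
  have d: "?d \<ge> 1"
  proof (cases "card u = 0")
    case False
    then have "real (card u) \<ge> 1" by linarith
    then show ?thesis using lam1(1) by (simp add: rpow_def ge_one_powr_ge_zero)
  qed (simp add: rpow_def)
  have "rate lam lam1 (card u) m \<le> lf * ?d * (2 powr lam * x powr (- lam))"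
  proof (cases "x \<ge> 1")
    \<comment> \<open>The rule is zero here and its rate is 1, which \<open>x powr (- lam)\<close>
      covers since \<open>x < 1\<close>.\<close>
    case False
    have "1 \<le> x powr (- lam)" using False x lam(1) powr_mono2'[of "-lam" x 1] by simp
    moreover have "(1::real) \<le> 2 powr lam" using lam(1) by (intro ge_one_powr_ge_zero) auto
    ultimately have "1 * 1 * (1 * 1) \<le> lf * ?d * (2 powr lam * x powr (- lam))"
      using lf(1) d by (intro mult_mono) auto
    then show ?thesis using False by (simp add: rate_def m round_pow2_def)
  next
    case True
    have m1: "m \<ge> 1" using True by (simp add: m round_pow2_def)
    have "(x / 2) powr lam \<le> real m powr lam"
      using round_pow2_ge[OF True] x lam(1) by (intro powr_mono2) (auto simp: m)
    then have inv: "1 / real m powr lam \<le> 2 powr lam * x powr (- lam)"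
      using x m1 by (simp add: powr_divide powr_minus_divide field_simps)
    have num: "max 1 (rpow (ln (real m)) (lam1 * real (card u))) \<le> lf * ?d"
    proof (rule max.boundedI)
      show "1 \<le> lf * ?d" using lf(1) d mult_mono[of 1 lf 1 ?d] by simp
      show "rpow (ln (real m)) (lam1 * real (card u)) \<le> lf * ?d"
      proof (cases "lam1 * real (card u) = 0")
        case True
        then show ?thesis using \<open>1 \<le> lf * ?d\<close> by (simp add: rpow_def)
      next
        case False
        then have ne: "u \<noteq> {}" by auto
        \<comment> \<open>This is where |u|^(lambda_1 |u|) is paid: it turns the power of ln m into
          the power of (ln m) / |u| in the log factor.\<close>
        have "ln (real m) = (ln (real m) / real (card u)) * real (card u)" using False by simp
        then have "rpow (ln (real m)) (lam1 * real (card u))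
            = rpow (ln (real m) / real (card u)) (lam1 * real (card u)) * ?d"
          using False by (simp add: rpow_def flip: powr_mult)
        also have "\<dots> \<le> lf * ?d" using lf(2)[OF ne m1] d by (intro mult_right_mono) auto
        finally show ?thesis .
      qed
    qed
    have "1 \<le> real m powr lam" using m1 lam(1) by (intro ge_one_powr_ge_zero) auto
    then have "rate lam lam1 (card u) m
        = max 1 (rpow (ln (real m)) (lam1 * real (card u))) * (1 / real m powr lam)"
      using m1 by (simp add: rate_def)
    also have "\<dots> \<le> lf * ?d * (2 powr lam * x powr (- lam))"
      using num inv lf(1) d by (intro mult_mono) auto
    finally show ?thesis .
  qed
  then have "weight \<gamma> u * (C u * rate lam lam1 (card u) m)
      \<le> weight \<gamma> u * (C u * (lf * ?d * (2 powr lam * x powr (- lam))))"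
    using weight_gt[of u] C_pos[OF assms(3)] by (intro mult_left_mono) auto
  then show ?thesis by (simp add: g_eq mult_ac)
qed

section \<open>Growth of the log factor as epsilon tends to 0\<close>

lemma active_card_growth:
  obtains b c d where "c \<ge> 0"
    "\<And>\<epsilon> u. \<epsilon> > 0 \<Longrightarrow> u \<in> active_set \<gamma> M q \<rho> \<epsilon> \<Longrightarrow> u \<noteq> {} \<Longrightarrow>
       real (card u) * ln (real (card u)) \<le> b * real (card u) + c * ln (1 / \<epsilon>) + d"
proof -
  define x where "x j = M powr pstar * \<gamma> j powr pstar" for j
  \<comment> \<open>The added 1 keeps \<open>X\<close> positive even when \<open>M = 0\<close>, so
    that its logarithm can be used.\<close>
  define X where "X = suminf x + 1"
  define e where "e = pstar / (1 - real_of_ereal (1 / \<rho>))"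
  have x: "x j \<ge> 0" for j by (simp add: x_def)
  have x_sm: "summable x"
    unfolding x_def[abs_def] by (rule summable_mult[OF gamma_summable])
  have X: "X \<ge> 1" "suminf x \<ge> 0" using suminf_nonneg[OF x_sm x] by (simp_all add: X_def)
  have e: "e \<ge> 0" using pstar(1) one_minus_inverse_rho(1) by (simp add: e_def)
  have "real (card u) * ln (real (card u)) \<le> (1 + ln X) * real (card u) + e * ln (1 / \<epsilon>) + e * ln (2 * D)"
    if \<epsilon>: "\<epsilon> > 0" and u: "u \<in> active_set \<gamma> M q \<rho> \<epsilon>" "u \<noteq> {}" for \<epsilon> u
  proof -
    define l where "l = card u"
    have fin: "finite u" using u by (simp add: active_set_iff)
    have l: "l > 0" using fin u by (simp add: l_def card_gt_0_iff)
    have "(\<epsilon> / 2 / D) powr e < wM u powr pstar"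
      using active_wM_gt[OF u(1) \<epsilon>] by (simp only: e_def)
    also have "\<dots> = prod x u"
      by (simp add: wM_powr weight_powr x_def prod.distrib)
    also have "\<dots> \<le> suminf x ^ l / fact l"
      unfolding l_def using fin x x_sm by (rule prod_le_power_div_fact)
    also have "\<dots> \<le> X ^ l / fact l"
      using X by (intro divide_right_mono power_mono) (auto simp: X_def)
    also have "\<dots> = X ^ l * (1 / fact l)" by simp
    also have "\<dots> \<le> X ^ l * (exp (real l) / real l ^ l)"
      using power_self_le_fact[of l] l X(1) by (intro mult_left_mono) (auto simp: divide_simps)
    also have "\<dots> = X ^ l * exp (real l) / real l ^ l" by simp
    \<comment> \<open>The factorial has been replaced by l^l / e^l, so its logarithm supplies the
      term l ln l to be bounded.\<close>
    finally have "ln ((\<epsilon> / 2 / D) powr e) < ln (X ^ l * exp (real l) / real l ^ l)"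
      using \<epsilon> D_ge l X(1) by (subst ln_less_cancel_iff) auto
    then have "e * (ln \<epsilon> - ln (2 * D)) < real l * ln X + real l - real l * ln (real l)"
      using \<epsilon> D_ge l X(1) by (simp add: ln_powr ln_div ln_mult ln_realpow)
    then show ?thesis using \<epsilon> by (simp add: ln_div l_def algebra_simps)
  qed
  then show ?thesis using that[OF e] by blast
qed

lemma log_factor_growth:
  obtains B where "B \<ge> 0"
    "eventually (\<lambda>\<epsilon>. ln (log_factor lam1 (active_set \<gamma> M q \<rho> \<epsilon>) (n \<epsilon>))
       \<le> B * (ln (1 / \<epsilon>) / ln (ln (1 / \<epsilon>)) * ln (ln (ln (1 / \<epsilon>))))) (at_right 0)"
proof -
  obtain b c d where c: "c \<ge> 0"
    "\<And>\<epsilon> u. \<epsilon> > 0 \<Longrightarrow> u \<in> active_set \<gamma> M q \<rho> \<epsilon> \<Longrightarrow> u \<noteq> {} \<Longrightarrow>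
       real (card u) * ln (real (card u)) \<le> b * real (card u) + c * ln (1 / \<epsilon>) + d"
    by (rule active_card_growth) (rule that)
  define Kc where "Kc = 2 powr (1 / lam) * E powr (1 + r / lam)"
  define A where "A = 4 * (c + 2) + 1"
  have A: "A \<ge> 0" using c(1) by (simp add: A_def)
  have lim: "filterlim (\<lambda>\<epsilon>::real. ln (1 / \<epsilon>)) at_top (at_right 0)" by real_asymp
  have "eventually (\<lambda>\<epsilon>. \<forall>l x. l > 0 \<longrightarrow> x > 0 \<longrightarrow> l * ln l \<le> b * l + c * ln (1 / \<epsilon>) + d \<longrightarrow>
      x \<le> 1 / lam * ln (1 / \<epsilon>) + ln Kc \<longrightarrow>
      l * ln (x / l) \<le> A * (ln (1 / \<epsilon>) / ln (ln (1 / \<epsilon>)) * ln (ln (ln (1 / \<epsilon>))))) (at_right 0)"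
    unfolding A_def using c(1) lam(1)
    by (intro eventually_compose_filterlim[OF eventually_mult_ln_divide_le lim]) auto
  moreover have "eventually (\<lambda>\<epsilon>::real. \<epsilon> > 0) (at_right 0)"
    by (rule eventually_at_right_less)
  moreover have "eventually (\<lambda>\<epsilon>::real. ln (1 / \<epsilon>) / ln (ln (1 / \<epsilon>)) * ln (ln (ln (1 / \<epsilon>))) \<ge> 0) (at_right 0)"
    by real_asymp
  ultimately have "eventually (\<lambda>\<epsilon>. ln (log_factor lam1 (active_set \<gamma> M q \<rho> \<epsilon>) (n \<epsilon>))
       \<le> (lam1 * A) * (ln (1 / \<epsilon>) / ln (ln (1 / \<epsilon>)) * ln (ln (ln (1 / \<epsilon>))))) (at_right 0)"
  proof eventually_elim
    case (elim \<epsilon>)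
    let ?R = "ln (1 / \<epsilon>) / ln (ln (1 / \<epsilon>)) * ln (ln (ln (1 / \<epsilon>)))"
    let ?U = "active_set \<gamma> M q \<rho> \<epsilon>"
    have R: "lam1 * A * ?R \<ge> 0" using mult_nonneg_nonneg[OF mult_nonneg_nonneg[OF lam1(1) A] elim(3)] .
    have "log_factor lam1 ?U (n \<epsilon>) \<le> exp (lam1 * A * ?R)"
    proof (rule log_factor_le[OF finite_active_set[OF elim(2)]])
      show "1 \<le> exp (lam1 * A * ?R)" using R by simp
    next
      fix u assume u: "u \<in> ?U" "u \<noteq> {}" "n \<epsilon> u \<ge> 1"
      let ?x = "ln (real (n \<epsilon> u))" and ?l = "real (card u)"
      have l: "?l > 0" using u by (simp add: active_set_iff card_gt_0_iff)
      show "rpow (?x / ?l) (lam1 * ?l) \<le> exp (lam1 * A * ?R)"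
      \<comment> \<open>The asymptotic estimate needs a positive logarithm. In the excluded cases
        the power is 1 (for \<open>lam1 = 0\<close>) or 0 (for a single node).\<close>
      proof (cases "lam1 = 0 \<or> ?x = 0")
        case True
        then show ?thesis using R by (auto simp: rpow_def)
      next
        case False
        then have x: "?x > 0" using u(3) by (metis less_eq_real_def ln_ge_zero of_nat_1 of_nat_mono)
        have nK: "real (n \<epsilon> u) \<le> Kc * \<epsilon> powr (- 1 / lam)"
          unfolding Kc_def using elim(2) u(1) by (rule n_le)
        moreover have "real (n \<epsilon> u) > 0" using u(3) by simp
        ultimately have "Kc * \<epsilon> powr (- 1 / lam) > 0" by linarith
        \<comment> \<open>The positivity of \<open>E\<close> hidden here is read off from the
          existence of a component with at least one node.\<close>
        then have Kc: "Kc > 0" by (simp add: zero_less_mult_iff)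
        have "?x \<le> ln (Kc * \<epsilon> powr (- 1 / lam))"
          using nK u(3) by simp
        also have "\<dots> = 1 / lam * ln (1 / \<epsilon>) + ln Kc"
          using elim(2) Kc by (simp add: ln_mult ln_powr ln_div)
        finally have "?l * ln (?x / ?l) \<le> A * ?R"
          using elim(1) l x c(2)[OF elim(2) u(1,2)] by blast
        then have "lam1 * (?l * ln (?x / ?l)) \<le> lam1 * (A * ?R)"
          using lam1(1) by (rule mult_left_mono)
        moreover have "rpow (?x / ?l) (lam1 * ?l) = exp (lam1 * (?l * ln (?x / ?l)))"
          using False l x by (simp add: rpow_def powr_def)
        ultimately show ?thesis by (simp add: mult.assoc)
      qed
    qed
    then have "ln (log_factor lam1 ?U (n \<epsilon>)) \<le> ln (exp (lam1 * A * ?R))"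
      using log_factor_upper(1)[OF finite_active_set[OF elim(2)], of lam1 "n \<epsilon>"]
      by (subst ln_le_cancel_iff) auto
    then show ?case by simp
  qed
  then show ?thesis using that[of "lam1 * A"] A lam1(1) by simp
qed

text \<open>The solution of epsilon^(-delta) = log factor; it is determined by this equation except
  at epsilon = 1.\<close>

definition \<delta> where
  "\<delta> \<epsilon> = - ln (log_factor lam1 (active_set \<gamma> M q \<rho> \<epsilon>) (n \<epsilon>)) / ln \<epsilon>"

lemma powr_one_minus_\<delta>:
  assumes "\<epsilon> > 0" "\<epsilon> \<noteq> 1"
  shows "\<epsilon> powr (1 - \<delta> \<epsilon>) = \<epsilon> * log_factor lam1 (active_set \<gamma> M q \<rho> \<epsilon>) (n \<epsilon>)"
proof -
  let ?l = "log_factor lam1 (active_set \<gamma> M q \<rho> \<epsilon>) (n \<epsilon>)"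
  have "?l > 0" using log_factor_upper(1)[OF finite_active_set[OF assms(1)], of lam1 "n \<epsilon>"] by linarith
  moreover have "\<epsilon> powr (- \<delta> \<epsilon>) = exp (ln ?l)"
    using assms by (simp add: \<delta>_def powr_def)
  ultimately have "\<epsilon> powr (- \<delta> \<epsilon>) = ?l" by simp
  then show ?thesis using assms(1) powr_add[of \<epsilon> 1 "- \<delta> \<epsilon>"] by simp
qed

lemma \<delta>_bigo: "\<delta> \<in> O[at_right 0](\<lambda>\<epsilon>. ln (ln (ln (1 / \<epsilon>))) / ln (ln (1 / \<epsilon>)))"
proof -
  obtain B where B: "B \<ge> 0" and
    ev: "eventually (\<lambda>\<epsilon>. ln (log_factor lam1 (active_set \<gamma> M q \<rho> \<epsilon>) (n \<epsilon>))
       \<le> B * (ln (1 / \<epsilon>) / ln (ln (1 / \<epsilon>)) * ln (ln (ln (1 / \<epsilon>))))) (at_right 0)"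
    using log_factor_growth by blast
  show ?thesis
  proof (rule bigoI[where c = B])
    have "eventually (\<lambda>\<epsilon>::real. \<epsilon> > 0) (at_right 0)" by (rule eventually_at_right_less)
    moreover have "eventually (\<lambda>\<epsilon>::real. ln (1 / \<epsilon>) > 0) (at_right 0)" by real_asymp
    ultimately show "eventually (\<lambda>\<epsilon>. norm (\<delta> \<epsilon>) \<le> B * norm (ln (ln (ln (1 / \<epsilon>))) / ln (ln (1 / \<epsilon>)))) (at_right 0)"
      using ev
    proof eventually_elim
      case (elim \<epsilon>)
      let ?l = "log_factor lam1 (active_set \<gamma> M q \<rho> \<epsilon>) (n \<epsilon>)" and ?w = "ln (1 / \<epsilon>)"
      have "ln ?l \<ge> 0" using log_factor_upper(1)[OF finite_active_set[OF elim(1)]] by simp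
      moreover have "\<delta> \<epsilon> = ln ?l / ?w" using elim(1) by (simp add: \<delta>_def ln_div)
      ultimately have "norm (\<delta> \<epsilon>) = ln ?l / ?w" using elim(2) by simp
      also have "\<dots> \<le> B * (?w / ln ?w * ln (ln ?w)) / ?w"
        using elim by (intro divide_right_mono) auto
      also have "\<dots> = B * (ln (ln ?w) / ln ?w)" using elim(2) by simp
      also have "\<dots> \<le> B * norm (ln (ln ?w) / ln ?w)" using B by (intro mult_left_mono) (simp_all only: real_norm_def abs_ge_self)
      finally show ?case .
    qed
  qed
qed

lemma \<delta>_smallo: "\<delta> \<in> o[at_right 0](\<lambda>_. 1)"
proof (rule landau_o.big_small_trans[OF \<delta>_bigo])
  show "(\<lambda>\<epsilon>::real. ln (ln (ln (1 / \<epsilon>))) / ln (ln (1 / \<epsilon>))) \<in> o[at_right 0](\<lambda>_. 1)"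
    by real_asymp
qed

end

subsection \<open>The error bound\<close>

lemma mdm_error_bound:
  assumes R: "product_rkhs_setting \<mu> K M H ip"
    and W: "mdm_weights \<gamma> M q \<rho> pstar lam lam1 C cst"
    and pq: "1 \<le> p" "1 \<le> q" "1 / p + 1 / q = 1"
    and rules: "\<And>u N f. finite u \<Longrightarrow> N = 0 \<or> (\<exists>m. N = 2 ^ m) \<Longrightarrow> f \<in> H u \<Longrightarrow>
      \<bar>(LINT x|(\<Pi>\<^sub>M j\<in>u. \<mu>). f x) - cubature w t u N f\<bar>
        \<le> ip_norm (ip u) f * C u * rate lam lam1 (card u) N"
    and F: "in_H_space \<mu> \<gamma> p H ip F Fu"
    and \<epsilon>: "\<epsilon> > 0"
    and A: "A = active_set \<gamma> M q \<rho> \<epsilon>"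
    and n: "n = mdm_weights.n \<gamma> M q \<rho> lam lam1 C cst \<epsilon>"
  shows "\<bar>(LINT y|(\<Pi>\<^sub>M j\<in>UNIV. \<mu>). F y) - mdm w t A n Fu\<bar>
    \<le> \<epsilon> * H_norm \<gamma> p ip Fu * log_factor lam1 A n"
proof -
  interpret R: product_rkhs_setting \<mu> K M H ip by (rule R)
  interpret W: mdm_weights \<gamma> M q \<rho> pstar lam lam1 C cst by (rule W)
  define N where "N = H_norm \<gamma> p ip Fu"
  define lf where "lf = log_factor lam1 A n"
  define a where "a u = (LINT x|(\<Pi>\<^sub>M j\<in>u. \<mu>). Fu u x)" for u
  define nF where "nF u = ip_norm (ip u) (Fu u)" for u
  have Fu: "Fu u \<in> H u" if "finite u" for u using F that by (simp add: in_H_space_def)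
  have nF: "nF u \<ge> 0" if "finite u" for u
    unfolding nF_def by (rule rkhs.ip_norm_nonneg[OF R.spaces[OF that] Fu[OF that]])
  have Hoelder: "(\<Sum>u\<in>T. nF u * b u) \<le> N * B"
    if "finite T" "\<And>u. u \<in> T \<Longrightarrow> finite u" "\<And>u. u \<in> T \<Longrightarrow> b u \<ge> 0" "B \<ge> 0"
      "lq_bounded q (\<lambda>u. weight \<gamma> u * b u) T B" for T b B
    unfolding nF_def N_def using that F nF
    by (intro sum_ip_norm_le_H_norm[OF pq W.gamma_pos]) (auto simp: in_H_space_def nF_def)
  have A_fin: "finite A" unfolding A using W.finite_active_set[OF \<epsilon>] .
  have A_mem: "finite u" if "u \<in> A" for u using that unfolding A by (simp add: W.active_set_iff)
  \<comment> \<open>Hoelder's inequality over the empty set reads 0 <= N * 1.\<close>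
  have N: "N \<ge> 0" using Hoelder[of "{}" "\<lambda>_. 0" 1] by (simp add: lq_bounded_def)
  have lf: "lf \<ge> 1" unfolding lf_def using A_fin by (rule log_factor_upper)
  have wM: "W.wM = (\<lambda>u. weight \<gamma> u * M ^ card u)" by (rule ext) (rule W.wM_def)
  have M: "M ^ m \<ge> 0" for m using R.M_nonneg by simp

  \<comment> \<open>This summability is the hypothesis under which the integral of F splits into the
    integrals of its components.\<close>
  have "(\<lambda>u. nF u * M ^ card u) summable_on {u. finite u}"
  proof -
    obtain B where B: "B \<ge> 0" "\<And>T. finite T \<Longrightarrow> (\<And>u. u \<in> T \<Longrightarrow> finite u) \<Longrightarrow> lq_bounded q W.wM T B"
      using W.wM_lq_bounded by blast
    show ?thesis
    proof (rule nonneg_bdd_above_summable_on)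
      show "bdd_above (sum (\<lambda>u. nF u * M ^ card u) ` {F. F \<subseteq> {u. finite u} \<and> finite F})"
        using B M by (intro bdd_aboveI2[where M = "N * B"] Hoelder) (auto simp: wM)
    qed (use nF M in auto)
  qed
  then have "(a has_sum (LINT y|(\<Pi>\<^sub>M j\<in>UNIV. \<mu>). F y)) {u. finite u}"
    unfolding a_def nF_def using F Fu
    by (intro R.integral_has_sum_components) (auto simp: in_H_space_def)
  then have "(a has_sum ((LINT y|(\<Pi>\<^sub>M j\<in>UNIV. \<mu>). F y) - sum a A)) ({u. finite u} - A)"
    using A_fin A_mem by (intro has_sum_Diff has_sum_finite) auto
  then have trunc: "\<bar>(LINT y|(\<Pi>\<^sub>M j\<in>UNIV. \<mu>). F y) - sum a A\<bar> \<le> N * (\<epsilon> / 2)"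
  proof (rule abs_has_sum_le)
    fix T assume T: "finite T" "T \<subseteq> {u. finite u} - A"
    have "\<bar>sum a T\<bar> \<le> (\<Sum>u\<in>T. \<bar>a u\<bar>)" by (rule sum_abs)
    also have "\<dots> \<le> (\<Sum>u\<in>T. nF u * M ^ card u)"
      unfolding a_def nF_def using T Fu by (intro sum_mono R.abs_component_integral_le) auto
    also have "\<dots> \<le> N * (\<epsilon> / 2)"
      using T M \<epsilon> W.truncation_lq_bounded[OF \<epsilon>, of T]
      by (intro Hoelder) (auto simp: wM A)
    finally show "\<bar>sum a T\<bar> \<le> N * (\<epsilon> / 2)" .
  qed

  have rate0: "C u * rate lam lam1 (card u) (n u) \<ge> 0" if "u \<in> A" for u
    using W.C_pos[OF A_mem[OF that]] by (simp add: rate_def)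
  have "\<bar>sum a A - mdm w t A n Fu\<bar> = \<bar>\<Sum>u\<in>A. a u - cubature w t u (n u) (Fu u)\<bar>"
    by (simp add: mdm_def sum_subtractf)
  also have "\<dots> \<le> (\<Sum>u\<in>A. \<bar>a u - cubature w t u (n u) (Fu u)\<bar>)" by (rule sum_abs)
  also have "\<dots> \<le> (\<Sum>u\<in>A. nF u * (C u * rate lam lam1 (card u) (n u)))"
  proof (rule sum_mono)
    fix u assume u: "u \<in> A"
    have "n u = 0 \<or> (\<exists>m. n u = 2 ^ m)" by (auto simp: n W.n_def round_pow2_def)
    then show "\<bar>a u - cubature w t u (n u) (Fu u)\<bar> \<le> nF u * (C u * rate lam lam1 (card u) (n u))"
      using rules[OF A_mem[OF u] _ Fu[OF A_mem[OF u]]] by (simp add: a_def nF_def mult.assoc)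
  qed
  also have "\<dots> \<le> N * (lf * (\<epsilon> / 2))"
  proof (rule Hoelder[OF A_fin A_mem rate0])
    show "lq_bounded q (\<lambda>u. weight \<gamma> u * (C u * rate lam lam1 (card u) (n u))) A (lf * (\<epsilon> / 2))"
    proof (rule lq_bounded_mult_le[OF pq(2)])
      show "lq_bounded q (\<lambda>u. W.g u * W.k \<epsilon> u powr (- lam)) A (\<epsilon> / 2)"
        unfolding A using W.cubature_lq_bounded[OF \<epsilon>] .
      fix u assume u: "u \<in> A"
      show "0 \<le> weight \<gamma> u * (C u * rate lam lam1 (card u) (n u))"
        using rate0[OF u] W.weight_gt[of u] by simp
      show "0 \<le> W.g u * W.k \<epsilon> u powr (- lam)"
        using W.g_pos[OF A_mem[OF u]] by simp
      show "weight \<gamma> u * (C u * rate lam lam1 (card u) (n u)) \<le> lf * (W.g u * W.k \<epsilon> u powr (- lam))"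
      proof (rule W.rate_le)
        show "W.k \<epsilon> u > 0" using u unfolding A by (intro W.k_pos \<epsilon>)
        show "n u = round_pow2 (W.k \<epsilon> u)" by (simp add: n W.n_def)
        show "u \<noteq> {} \<Longrightarrow> n u \<ge> 1 \<Longrightarrow> rpow (ln (real (n u)) / real (card u)) (lam1 * real (card u)) \<le> lf"
          unfolding lf_def using A_fin u by (intro log_factor_upper(2))
      qed (use A_mem u lf in auto)
    qed (use \<epsilon> lf in auto)
  qed (use \<epsilon> lf in auto)
  finally have "\<bar>sum a A - mdm w t A n Fu\<bar> \<le> N * (lf * (\<epsilon> / 2))" .
  \<comment> \<open>Since the log factor is at least 1, the truncation half can be enlarged to match
    the cubature half.\<close>
  moreover have "N * (\<epsilon> / 2) \<le> N * (lf * (\<epsilon> / 2))"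
    using N lf \<epsilon> by (intro mult_left_mono) auto
  ultimately have "\<bar>(LINT y|(\<Pi>\<^sub>M j\<in>UNIV. \<mu>). F y) - mdm w t A n Fu\<bar> \<le> 2 * (N * (lf * (\<epsilon> / 2)))"
    using trunc by linarith
  then show ?thesis by (simp add: N_def lf_def mult_ac)
qed

theorem theorem1:
  fixes \<Omega> :: "real set"
    and \<mu> :: "real measure"
    and K :: "real \<Rightarrow> real \<Rightarrow> real"
    and M :: real
    and \<gamma> :: "nat \<Rightarrow> real"
    and H :: "nat set \<Rightarrow> ((nat \<Rightarrow> real) \<Rightarrow> real) set"
    and ip :: "nat set \<Rightarrow> ((nat \<Rightarrow> real) \<Rightarrow> real) \<Rightarrow> ((nat \<Rightarrow> real) \<Rightarrow> real) \<Rightarrow> real"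
    and p q \<rho> :: ereal
    and pstar lam lam1 :: real
    and C :: "nat set \<Rightarrow> real"
    and cst :: "nat \<Rightarrow> real"
    and w :: "nat set \<Rightarrow> nat \<Rightarrow> nat \<Rightarrow> real"
    and t :: "nat set \<Rightarrow> nat \<Rightarrow> nat \<Rightarrow> nat \<Rightarrow> real"
    and U :: "real \<Rightarrow> nat set set"
    and k :: "real \<Rightarrow> nat set \<Rightarrow> real"
    and n :: "real \<Rightarrow> nat set \<Rightarrow> nat"
  assumes prob: "prob_space \<mu>" "space \<mu> = \<Omega>"
    and kernel: "reproducing_kernel_on \<Omega> K"
    and kernel_measurable: "\<And>y. y \<in> \<Omega> \<Longrightarrow> (\<lambda>x. K x y) \<in> borel_measurable \<mu>"
    and kernel_integrable: "integrable \<mu> (\<lambda>y. sqrt (K y y))"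
    and M: "M = (LINT y|\<mu>. sqrt (K y y))"
    and spaces: "\<And>u. finite u \<Longrightarrow> rkhs (u \<rightarrow>\<^sub>E \<Omega>) (product_kernel K u) (H u) (ip u)"
    and gamma_pos: "\<And>j. \<gamma> j > 0"
    and exponents: "1 \<le> p" "1 \<le> q" "1 / p + 1 / q = 1"
    and pstar: "0 < pstar" "ereal pstar < q"
    and gamma_summable: "summable (\<lambda>j. \<gamma> j powr pstar)"
    and rho: "1 < \<rho>" "\<rho> \<le> q / ereal pstar"
    and lam: "0 < lam" "lam \<le> 1 / pstar - real_of_ereal (1 / q)"
    and lam1: "0 \<le> lam1" "lam1 < lam + real_of_ereal (1 / q)"
    and C_pos: "\<And>u. finite u \<Longrightarrow> C u > 0"
    and C_exp: "at_most_exponential C"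
    and cst_ge: "\<And>d. cst d \<ge> 1"
    and cst_exp: "at_most_exponential (\<lambda>u. cst (card u))"
    and nodes: "\<And>u m i. finite u \<Longrightarrow> i < 2 ^ m \<Longrightarrow> t u (2 ^ m) i \<in> u \<rightarrow>\<^sub>E \<Omega>"
    and rules: "\<And>u N f. finite u \<Longrightarrow> N = 0 \<or> (\<exists>m. N = 2 ^ m) \<Longrightarrow> f \<in> H u \<Longrightarrow>
      \<bar>(LINT x|(\<Pi>\<^sub>M j\<in>u. \<mu>). f x) - cubature w t u N f\<bar>
        \<le> ip_norm (ip u) f * C u * rate lam lam1 (card u) N"
    and U: "U = (\<lambda>\<epsilon>. active_set \<gamma> M q \<rho> \<epsilon>)"
    and k: "k = (\<lambda>\<epsilon> u. k_choice (error_weight \<gamma> C lam lam1) cst q lam (U \<epsilon>) \<epsilon> u)"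
    and n: "n = (\<lambda>\<epsilon> u. round_pow2 (k \<epsilon> u))"
  shows "(\<exists>\<delta> :: real \<Rightarrow> real.
      (\<forall>F Fu. in_H_space \<mu> \<gamma> p H ip F Fu \<longrightarrow>
        (\<forall>\<epsilon>>0.
          \<bar>(LINT y|(\<Pi>\<^sub>M j\<in>UNIV. \<mu>). F y) - mdm w t (U \<epsilon>) (n \<epsilon>) Fu\<bar>
            \<le> \<epsilon> * H_norm \<gamma> p ip Fu * log_factor lam1 (U \<epsilon>) (n \<epsilon>) \<and>
          (\<epsilon> \<noteq> 1 \<longrightarrow>
            \<epsilon> * H_norm \<gamma> p ip Fu * log_factor lam1 (U \<epsilon>) (n \<epsilon>)
              = H_norm \<gamma> p ip Fu * \<epsilon> powr (1 - \<delta> \<epsilon>)))) \<and>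
      \<delta> \<in> O[at_right 0](\<lambda>\<epsilon>. ln (ln (ln (1 / \<epsilon>))) / ln (ln (1 / \<epsilon>))) \<and>
      \<delta> \<in> o[at_right 0](\<lambda>_. 1)) \<and>
    (\<exists>c. \<forall>\<epsilon>>0. mdm_cost cst (U \<epsilon>) (n \<epsilon>) \<le> c * \<epsilon> powr (- 1 / lam))"
proof -
  have R: "product_rkhs_setting \<mu> K M H ip"
    using prob kernel kernel_measurable kernel_integrable M spaces
    by (simp add: product_rkhs_setting_def product_rkhs_setting_axioms_def)
  interpret R: product_rkhs_setting \<mu> K M H ip by (rule R)
  have W: "mdm_weights \<gamma> M q \<rho> pstar lam lam1 C cst"
    by unfold_locales (fact | rule R.M_nonneg)+
  interpret W: mdm_weights \<gamma> M q \<rho> pstar lam lam1 C cst by (rule W)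
  have n_eq: "n \<epsilon> = W.n \<epsilon>" for \<epsilon>
    by (rule ext) (simp add: n k U W.n_def W.k_def W.g_def)
  have U_eq: "U \<epsilon> = active_set \<gamma> M q \<rho> \<epsilon>" for \<epsilon> by (simp add: U)
  show ?thesis
  \<comment> \<open>Both witnesses are built from the weights, exponents and constants alone, so
    they are uniform in F.\<close>
  proof (intro conjI exI[of _ W.\<delta>] exI[of _ "2 powr (1 / lam) * W.E powr (1 + W.r / lam)"] allI impI)
    fix F Fu \<epsilon> assume F: "in_H_space \<mu> \<gamma> p H ip F Fu" and \<epsilon>: "(0::real) < \<epsilon>"
    show "\<bar>(LINT y|(\<Pi>\<^sub>M j\<in>UNIV. \<mu>). F y) - mdm w t (U \<epsilon>) (n \<epsilon>) Fu\<bar>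
        \<le> \<epsilon> * H_norm \<gamma> p ip Fu * log_factor lam1 (U \<epsilon>) (n \<epsilon>)"
      by (rule mdm_error_bound[OF R W exponents rules F \<epsilon> U_eq n_eq])
    assume "\<epsilon> \<noteq> 1"
    then show "\<epsilon> * H_norm \<gamma> p ip Fu * log_factor lam1 (U \<epsilon>) (n \<epsilon>)
        = H_norm \<gamma> p ip Fu * \<epsilon> powr (1 - W.\<delta> \<epsilon>)"
      using W.powr_one_minus_\<delta>[OF \<epsilon>] by (simp add: U_eq n_eq)
  next
    show "mdm_cost cst (U \<epsilon>) (n \<epsilon>) \<le> 2 powr (1 / lam) * W.E powr (1 + W.r / lam) * \<epsilon> powr (- 1 / lam)"
      if "\<epsilon> > 0" for \<epsilon>
      unfolding U_eq n_eq using W.cost_le[OF that] .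
  qed (rule W.\<delta>_bigo W.\<delta>_smallo)+
qed

end
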